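(* For $n\ge 1$ we have $$\widetilde{A}_n(x,y,t\,|\,\alpha)=\sum_{j=0}^{\lfloor n/2\rfloor}\widetilde{\gamma}_{n,j}(\alpha,t)(xy)^j(x+y)^{n-2j},$$ where, for each $0\le j\le\lfloor n/2\rfloor$, $\widetilde{\gamma}_{n,j}(\alpha,t)$ is given by each of the following six (equal) expressions: $$\widetilde{\gamma}_{n,j}(\alpha,t)=\sum_{\substack{\sigma\in\mathcal{M}_{n+1}\\ \mathrm{da}(\sigma)=0,\ \mathrm{asc}(\sigma)=j}}\alpha^{\mathrm{rmax}(\sigma)-1}t^{\mathrm{rmaxdd}(\sigma)}=\sum_{\substack{\sigma\in\mathfrak{S}_n\\ \mathrm{cda}(\sigma)=0,\ \mathrm{exc}(\sigma)=j}}\alpha^{\mathrm{cyc}(\sigma)}t^{\mathrm{fix}(\sigma)};$$ $$\widetilde{\gamma}_{n,j}(\alpha,t)=\sum_{\substack{\sigma\in\mathcal{M}_{n+1}\\ \mathrm{dd}(\sigma)=0,\ \mathrm{des}(\sigma)=j}}\alpha^{\mathrm{lmax}(\sigma)+\mathrm{rmax}(\sigma)-2}t^{\mathrm{lmaxda}(\sigma)}=\sum_{\substack{\sigma\in\mathfrak{S}_n\\ \mathrm{cdd}(\sigma)=0,\ \mathrm{drop}(\sigma)=j}}\alpha^{\mathrm{cyc}(\sigma)}t^{\mathrm{fix}(\sigma)};$$ $$\widetilde{\gamma}_{n,j}(\alpha,t)=2^{2j-n}\sum_{\substack{\sigma\in\mathcal{M}_{n+1}\\ \mathrm{pk}(\sigma)=j+1}}\alpha^{\mathrm{lmax}(\sigma)+\mathrm{rmax}(\sigma)-2}t^{\mathrm{lmaxda}(\sigma)+\mathrm{rmaxdd}(\sigma)}=2^{2j-n}\sum_{\substack{\sigma\in\mathfrak{S}_n\\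 \mathrm{cpk}(\sigma)=j}}\alpha^{\mathrm{cyc}(\sigma)}(2t)^{\mathrm{fix}(\sigma)}.$$
   Context: $\mathfrak{S}_m$ is the symmetric group on $[m]$; permutations are also written as words $\sigma=\sigma_1\cdots\sigma_m$. $\mathcal{M}_m$ is the set of $\sigma\in\mathfrak{S}_m$ such that the first descent (if any) of $\sigma$ appears at the letter $m$, i.e. if $i$ is the smallest index with $\sigma_i>\sigma_{i+1}$ then $\sigma_i=m$. Linear statistics: $\mathrm{asc}$ (resp. $\mathrm{des}$) is the number of $1\le i\le m-1$ with $\sigma_i<\sigma_{i+1}$ (resp. $\sigma_i>\sigma_{i+1}$). With the convention $\sigma_0=\sigma_{m+1}=0$, a letter $\sigma_i$ ($1\le i\le m$) is a peak if $\sigma_{i-1}<\sigma_i>\sigma_{i+1}$, a double ascent if $\sigma_{i-1}<\sigma_i<\sigma_{i+1}$, a double descent if $\sigma_{i-1}>\sigma_i>\sigma_{i+1}$; their numbers are $\mathrm{pk},\mathrm{da},\mathrm{dd}$. $\sigma_i$ is a left-to-right (resp. right-to-left) maximum if it is larger than all letters of $\sigma$ to its left (resp. right); $\mathrm{lmax},\mathrm{rmax}$ are their numbers. $\mathrm{lmaxda}$ is the number of left-to-right maxima that are double ascents and $\mathrm{rmaxdd}$ the number of right-to-left maxima that are double descents. Cyclic statistics: $\mathrm{exc},\mathrm{drop},\mathrm{fix}$ count the $i$ with $i<\sigma(i)$, $i>\sigma(i)$, $i=\sigma(i)$; $\mathrm{cyc}$ is the number of cycles (fixed points included); $\mathrm{cpk},\mathrm{cda},\mathrm{cdd}$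 count the $i$ with $\sigma^{-1}(i)<i>\sigma(i)$, $\sigma^{-1}(i)<i<\sigma(i)$, $\sigma^{-1}(i)>i>\sigma(i)$ respectively. The $(\alpha,t)$-binomial-Eulerian polynomials are $$\widetilde{A}_n(x,y,t\,|\,\alpha)=\sum_{\sigma\in\mathcal{M}_{n+1}}x^{\mathrm{asc}(\sigma)}y^{\mathrm{des}(\sigma)}t^{\mathrm{lmaxda}(\sigma)+\mathrm{rmaxdd}(\sigma)}\alpha^{\mathrm{lmax}(\sigma)+\mathrm{rmax}(\sigma)-2}.$$ *)

theory Defs
  imports Complex_Main "HOL-Combinatorics.Orbits"
begin

text \<open>
  A permutation of \<open>[m] = {1..m}\<close> is a function \<open>\<sigma> :: nat \<Rightarrow> nat\<close> with \<open>\<sigma> permutes {1..m}\<close>;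
  its word is \<open>\<sigma> 1, \<dots>, \<sigma> m\<close>. Outside \<open>{1..m}\<close> such a \<open>\<sigma>\<close> is the identity, so the length \<open>m\<close>
  is an explicit argument of every statistic. All statistics count positions \<open>i\<close>, which amounts
  to counting letters \<open>\<sigma> i\<close> since \<open>\<sigma>\<close> is injective.
\<close>

definition Sym :: "nat \<Rightarrow> (nat \<Rightarrow> nat) set" where
  "Sym m = {\<sigma>. \<sigma> permutes {1..m}}"

definition MM :: "nat \<Rightarrow> (nat \<Rightarrow> nat) set" where
  "MM m = {\<sigma> \<in> Sym m. \<forall>i \<in> {1..<m}.
     \<sigma> i > \<sigma> (i + 1) \<and> (\<forall>k \<in> {1..<i}. \<not> \<sigma> k > \<sigma> (k + 1)) \<longrightarrow> \<sigma> i = m}"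


subsection \<open>Linear statistics\<close>

definition asc :: "nat \<Rightarrow> (nat \<Rightarrow> nat) \<Rightarrow> nat" where
  "asc m \<sigma> = card {i \<in> {1..<m}. \<sigma> i < \<sigma> (i + 1)}"

definition des :: "nat \<Rightarrow> (nat \<Rightarrow> nat) \<Rightarrow> nat" where
  "des m \<sigma> = card {i \<in> {1..<m}. \<sigma> i > \<sigma> (i + 1)}"

text \<open>The convention \<open>\<sigma>\<^sub>0 = \<sigma>\<^bsub>m+1\<^esub> = 0\<close>. It applies to peaks, double ascents and double descents only.\<close>

definition letter :: "nat \<Rightarrow> (nat \<Rightarrow> nat) \<Rightarrow> nat \<Rightarrow> nat" where
  "letter m \<sigma> i = (if 1 \<le> i \<and> i \<le> m then \<sigma> i else 0)"

definition peaks :: "nat \<Rightarrow> (nat \<Rightarrow> nat) \<Rightarrow> nat set" where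
  "peaks m \<sigma> = {i \<in> {1..m}.
     letter m \<sigma> (i - 1) < letter m \<sigma> i \<and> letter m \<sigma> i > letter m \<sigma> (i + 1)}"

definition double_ascents :: "nat \<Rightarrow> (nat \<Rightarrow> nat) \<Rightarrow> nat set" where
  "double_ascents m \<sigma> = {i \<in> {1..m}.
     letter m \<sigma> (i - 1) < letter m \<sigma> i \<and> letter m \<sigma> i < letter m \<sigma> (i + 1)}"

definition double_descents :: "nat \<Rightarrow> (nat \<Rightarrow> nat) \<Rightarrow> nat set" where
  "double_descents m \<sigma> = {i \<in> {1..m}.
     letter m \<sigma> (i - 1) > letter m \<sigma> i \<and> letter m \<sigma> i > letter m \<sigma> (i + 1)}"

definition lr_maxima :: "nat \<Rightarrow> (nat \<Rightarrow> nat) \<Rightarrow> nat set" where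
  "lr_maxima m \<sigma> = {i \<in> {1..m}. \<forall>k \<in> {1..<i}. \<sigma> k < \<sigma> i}"

definition rl_maxima :: "nat \<Rightarrow> (nat \<Rightarrow> nat) \<Rightarrow> nat set" where
  "rl_maxima m \<sigma> = {i \<in> {1..m}. \<forall>k \<in> {i<..m}. \<sigma> k < \<sigma> i}"

definition pk :: "nat \<Rightarrow> (nat \<Rightarrow> nat) \<Rightarrow> nat" where
  "pk m \<sigma> = card (peaks m \<sigma>)"

definition da :: "nat \<Rightarrow> (nat \<Rightarrow> nat) \<Rightarrow> nat" where
  "da m \<sigma> = card (double_ascents m \<sigma>)"

definition dd :: "nat \<Rightarrow> (nat \<Rightarrow> nat) \<Rightarrow> nat" where
  "dd m \<sigma> = card (double_descents m \<sigma>)"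

definition lmax :: "nat \<Rightarrow> (nat \<Rightarrow> nat) \<Rightarrow> nat" where
  "lmax m \<sigma> = card (lr_maxima m \<sigma>)"

definition rmax :: "nat \<Rightarrow> (nat \<Rightarrow> nat) \<Rightarrow> nat" where
  "rmax m \<sigma> = card (rl_maxima m \<sigma>)"

definition lmaxda :: "nat \<Rightarrow> (nat \<Rightarrow> nat) \<Rightarrow> nat" where
  "lmaxda m \<sigma> = card (lr_maxima m \<sigma> \<inter> double_ascents m \<sigma>)"

definition rmaxdd :: "nat \<Rightarrow> (nat \<Rightarrow> nat) \<Rightarrow> nat" where
  "rmaxdd m \<sigma> = card (rl_maxima m \<sigma> \<inter> double_descents m \<sigma>)"


subsection \<open>Cyclic statistics\<close>

definition exc :: "nat \<Rightarrow> (nat \<Rightarrow> nat) \<Rightarrow> nat" where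
  "exc m \<sigma> = card {i \<in> {1..m}. i < \<sigma> i}"

definition drops :: "nat \<Rightarrow> (nat \<Rightarrow> nat) \<Rightarrow> nat" where
  "drops m \<sigma> = card {i \<in> {1..m}. i > \<sigma> i}"

definition fixs :: "nat \<Rightarrow> (nat \<Rightarrow> nat) \<Rightarrow> nat" where
  "fixs m \<sigma> = card {i \<in> {1..m}. \<sigma> i = i}"

definition cyc :: "nat \<Rightarrow> (nat \<Rightarrow> nat) \<Rightarrow> nat" where
  "cyc m \<sigma> = card (orbit \<sigma> ` {1..m})"

definition cpk :: "nat \<Rightarrow> (nat \<Rightarrow> nat) \<Rightarrow> nat" where
  "cpk m \<sigma> = card {i \<in> {1..m}. inv \<sigma> i < i \<and> i > \<sigma> i}"

definition cda :: "nat \<Rightarrow> (nat \<Rightarrow> nat) \<Rightarrow> nat" where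
  "cda m \<sigma> = card {i \<in> {1..m}. inv \<sigma> i < i \<and> i < \<sigma> i}"

definition cdd :: "nat \<Rightarrow> (nat \<Rightarrow> nat) \<Rightarrow> nat" where
  "cdd m \<sigma> = card {i \<in> {1..m}. inv \<sigma> i > i \<and> i > \<sigma> i}"


subsection \<open>The \<open>(\<alpha>,t)\<close>-binomial-Eulerian polynomials\<close>

text \<open>
  Polynomials are given through their values at arbitrary ring elements. The subtraction of 2
  never truncates: \<open>lmax\<close> and \<open>rmax\<close> are positive on permutations of a nonempty \<open>[m]\<close>.
\<close>

definition binomial_Eulerian :: "nat \<Rightarrow> 'a::comm_semiring_1 \<Rightarrow> 'a \<Rightarrow> 'a \<Rightarrow> 'a \<Rightarrow> 'a" where
  "binomial_Eulerian n x y t \<alpha> =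
     (\<Sum>\<sigma> \<in> MM (n + 1).
        x ^ asc (n + 1) \<sigma> * y ^ des (n + 1) \<sigma>
        * t ^ (lmaxda (n + 1) \<sigma> + rmaxdd (n + 1) \<sigma>)
        * \<alpha> ^ (lmax (n + 1) \<sigma> + rmax (n + 1) \<sigma> - 2))"

end

theory Submission
  imports Defs
begin

text \<open>
  Words and permutations are both grown one element at a time, and everything follows from
  comparing the effect of one step on the statistics.

  A permutation of \<open>[n + 1]\<close> arises from one of \<open>[n]\<close> by making \<open>n + 1\<close> a fixed point or by inserting
  it into an arc \<open>i \<mapsto> b\<close> of a cycle. How the vector \<open>(p, a, d, z, c) = (cpk, cda, cdd, fix, cyc)\<close>
  changes depends only on the type of the arc, and the number of arcs of each type is read off
  from the same vector. So the sum over \<open>Sym (n + 1)\<close> of a function \<open>f\<close> of the vector is the sum over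
  \<open>Sym n\<close> of a transformed function, \<open>cycle_insertion f\<close> (\<open>sum_cyclic_weight_Suc\<close>).

  A word of \<open>MM m\<close> is an increasing run up to the letter \<open>m\<close>, followed by an arbitrary word. It is
  grown by raising all letters and inserting a new smallest letter, either at the very front or
  somewhere to the right of the top letter. The relevant vector \<open>(p, a, d, i, k, c)\<close> has entries
  \<open>p = pk - 1\<close>, \<open>i = rmaxdd\<close>, \<open>k = lmaxda\<close>, the remaining double ascents \<open>a\<close>, the remaining double
  descents \<open>d\<close>, and \<open>c = lmax + rmax - 2\<close>. Again there is an operator, \<open>word_insertion\<close>
  (\<open>sum_word_weight_Suc\<close>).

  The two operators match if each fixed point of a permutation is painted in one of two colours,
  \<open>i\<close> counting the first colour and \<open>k\<close> the second: summing a word function against the binomial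
  coefficients \<open>z choose i\<close> with \<open>i + k = z\<close> intertwines \<open>word_insertion\<close> with \<open>cycle_insertion\<close>. The
  point created in a step becomes Pascal's rule, and the point destroyed in a step becomes the
  identity \<open>i * (z choose i) = z * (z - 1 choose i - 1)\<close>. Hence a sum over \<open>MM (n + 1)\<close> is a sum over
  \<open>Sym n\<close> with two-coloured fixed points (\<open>sum_MM_eq_sum_Sym\<close>). By the same two identities, summing
  against \<open>s choose a\<close> with \<open>a + d = s\<close> reduces \<open>cycle_insertion\<close> to an operator in which double
  ascents and double descents are no longer distinguished (\<open>sum_Sym_eq_merged_total\<close>): for given
  \<open>(p, s, z, c)\<close> the double ascents are distributed like a free two-colouring of \<open>s\<close> points.

  In this merged model \<open>\<gamma>\<^sub>j\<close> is the total of \<open>\<alpha> ^ c * t ^ z\<close> over \<open>p = j\<close>. Admitting a single colour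
  in each two-colouring (no double ascents, or no double descents) gives the first four sums;
  admitting both with weight 1 gives a factor \<open>2 ^ (s + z)\<close> and hence the last two; giving the
  colours the weights \<open>x\<close> and \<open>y\<close> produces \<open>(x y)\<^sup>p (x + y) ^ (s + z)\<close>, which is the expansion of the
  binomial-Eulerian polynomial. Here \<open>s + z = n - 2 p\<close>, since cyclic peaks and cyclic valleys
  are equally many.
\<close>

section \<open>Binomially weighted sums\<close>

text \<open>
  The sum of \<open>\<phi>\<close> over all colourings of \<open>s\<close> points with two colours, where \<open>\<phi>\<close> only sees how often
  each colour occurs.
\<close>

definition binomial_sum :: "nat \<Rightarrow> (nat \<Rightarrow> nat \<Rightarrow> 'a::comm_semiring_1) \<Rightarrow> 'a" where
  "binomial_sum s \<phi> = (\<Sum>u\<le>s. of_nat (s choose u) * \<phi> u (s - u))"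

lemma binomial_sum_add:
  "binomial_sum s (\<lambda>u v. \<phi> u v + \<psi> u v) = binomial_sum s \<phi> + binomial_sum s \<psi>"
  by (simp add: binomial_sum_def sum.distrib distrib_left)

lemma binomial_sum_cmult:
  "binomial_sum s (\<lambda>u v. k * \<phi> u v) = k * binomial_sum s \<phi>"
  by (simp add: binomial_sum_def sum_distrib_left mult.left_commute)

lemma binomial_sum_cong:
  assumes "\<And>u v. u + v = s \<Longrightarrow> \<phi> u v = \<psi> u v"
  shows "binomial_sum s \<phi> = binomial_sum s \<psi>"
  unfolding binomial_sum_def by (intro sum.cong refl) (simp add: assms)

text \<open>
  Pascal's rule: the last point takes either colour. This handles the creation of a point by an
  insertion.
\<close>

lemma binomial_sum_Suc:
  "binomial_sum (Suc s) \<phi> = binomial_sum s (\<lambda>u v. \<phi> (Suc u) v + \<phi> u (Suc v))"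
proof -
  have "binomial_sum (Suc s) \<phi>
      = \<phi> 0 (Suc s) + (\<Sum>u\<le>s. of_nat (Suc s choose Suc u) * \<phi> (Suc u) (s - u))"
    unfolding binomial_sum_def by (subst sum.atMost_Suc_shift) simp
  also have "\<dots> = (\<Sum>u\<le>s. of_nat (s choose u) * \<phi> (Suc u) (s - u))
      + (\<phi> 0 (Suc s) + (\<Sum>u\<le>s. of_nat (s choose Suc u) * \<phi> (Suc u) (s - u)))"
    by (simp add: algebra_simps sum.distrib)
  also have "\<phi> 0 (Suc s) + (\<Sum>u\<le>s. of_nat (s choose Suc u) * \<phi> (Suc u) (s - u))
      = (\<Sum>u\<le>Suc s. of_nat (s choose u) * \<phi> u (Suc s - u))"
    by (subst sum.atMost_Suc_shift) simp
  also have "\<dots> = (\<Sum>u\<le>s. of_nat (s choose u) * \<phi> u (Suc (s - u)))"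
    by (simp add: Suc_diff_le binomial_eq_0)
  finally show ?thesis
    by (simp add: binomial_sum_def sum.distrib distrib_left)
qed

text \<open>
  The factor \<open>u\<close> chooses one point of the first colour and \<open>\<phi> (u - 1) v\<close> removes it; the point could
  have been chosen before colouring. This handles the destruction of a point by an insertion.
  For \<open>u = 0\<close> the truncated \<open>u - 1\<close> is harmless because of the factor.
\<close>

lemma binomial_sum_left_deriv:
  "binomial_sum s (\<lambda>u v. of_nat u * \<phi> (u - 1) v) = of_nat s * binomial_sum (s - 1) \<phi>"
proof (cases s)
  case (Suc m)
  have "binomial_sum s (\<lambda>u v. of_nat u * \<phi> (u - 1) v)
      = (\<Sum>u\<le>m. of_nat ((Suc m choose Suc u) * Suc u) * \<phi> u (m - u))"
    unfolding binomial_sum_def Suc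
    by (subst sum.atMost_Suc_shift) (simp add: mult.assoc of_nat_mult del: binomial_Suc_Suc of_nat_Suc mult_Suc_right)
  also have "\<dots> = (\<Sum>u\<le>m. of_nat (Suc m * (m choose u)) * \<phi> u (m - u))"
    by (simp only: Suc_times_binomial_eq)
  finally show ?thesis
    by (simp add: binomial_sum_def Suc sum_distrib_left mult.assoc of_nat_mult
        del: of_nat_Suc mult_Suc)
qed (simp add: binomial_sum_def)

lemma binomial_sum_swap: "binomial_sum s (\<lambda>u v. \<phi> v u) = binomial_sum s \<phi>"
  unfolding binomial_sum_def
  by (rule sum.reindex_bij_witness[of _ "\<lambda>u. s - u" "\<lambda>u. s - u"])
     (auto simp: binomial_symmetric[symmetric])

lemma binomial_sum_right_deriv:
  "binomial_sum s (\<lambda>u v. of_nat v * \<phi> u (v - 1)) = of_nat s * binomial_sum (s - 1) \<phi>"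
  using binomial_sum_left_deriv[of s "\<lambda>u v. \<phi> v u"]
    binomial_sum_swap[of s "\<lambda>u v. of_nat v * \<phi> u (v - 1)"] binomial_sum_swap[of "s - 1" \<phi>]
  by simp

lemma binomial_sum_powers: "binomial_sum s (\<lambda>u v. x ^ u * y ^ v) = (x + y) ^ s"
  by (simp add: binomial_sum_def binomial_ring mult.assoc)

lemma binomial_sum_const: "binomial_sum s (\<lambda>u v. k) = 2 ^ s * k"
  for k :: "'a::comm_semiring_1"
  using binomial_sum_powers[of s "1 :: 'a" 1] binomial_sum_cmult[of s k "\<lambda>u v. 1"]
  by (simp add: mult.commute)

lemma binomial_sum_left_zero:
  "binomial_sum s (\<lambda>u v. if u = 0 then \<phi> v else 0) = \<phi> s"
proof -
  have "binomial_sum s (\<lambda>u v. if u = 0 then \<phi> v else 0)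
     = (\<Sum>u\<le>s. if u = 0 then of_nat (s choose u) * \<phi> (s - u) else 0)"
    unfolding binomial_sum_def by (intro sum.cong) auto
  then show ?thesis by simp
qed

lemma binomial_sum_right_zero:
  "binomial_sum s (\<lambda>u v. if v = 0 then \<phi> u else 0) = \<phi> s"
  using binomial_sum_left_zero[of s \<phi>]
  by (simp add: binomial_sum_swap[of _ "\<lambda>u v. if v = 0 then \<phi> u else 0", symmetric])

section \<open>Insertion operators on statistics\<close>

text \<open>
  The effect of inserting the largest element, for a permutation with \<open>p\<close> cyclic peaks, \<open>a\<close> and \<open>d\<close>
  cyclic double ascents and descents, \<open>z\<close> fixed points and \<open>c\<close> cycles. The summands stand for a new
  fixed point, and for insertion next to a fixed point, on either side of a peak, before a double
  ascent, and after a double descent.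
\<close>

definition cycle_insertion ::
    "(nat \<Rightarrow> nat \<Rightarrow> nat \<Rightarrow> nat \<Rightarrow> nat \<Rightarrow> 'a) \<Rightarrow> nat \<Rightarrow> nat \<Rightarrow> nat \<Rightarrow> nat \<Rightarrow> nat \<Rightarrow> 'a::comm_semiring_1" where
  "cycle_insertion f p a d z c = f p a d (z + 1) (c + 1)
     + of_nat z * f (p + 1) a d (z - 1) c
     + of_nat p * (f p (a + 1) d z c + f p a (d + 1) z c)
     + of_nat a * f (p + 1) (a - 1) d z c
     + of_nat d * f (p + 1) a (d - 1) z c"

text \<open>
  The effect of inserting the smallest letter. It differs from \<open>cycle_insertion\<close> only in that the
  analogues of fixed points come in two kinds, counted by \<open>i\<close> and \<open>k\<close>: an insertion creates either kind
  but destroys only the first, since no letter can enter the increasing run before the top letter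
  except at its front.
\<close>

definition word_insertion ::
    "(nat \<Rightarrow> nat \<Rightarrow> nat \<Rightarrow> nat \<Rightarrow> nat \<Rightarrow> nat \<Rightarrow> 'a) \<Rightarrow> nat \<Rightarrow> nat \<Rightarrow> nat \<Rightarrow> nat \<Rightarrow> nat \<Rightarrow> nat \<Rightarrow> 'a::comm_semiring_1" where
  "word_insertion g p a d i k c = g p a d (i + 1) k (c + 1) + g p a d i (k + 1) (c + 1)
     + of_nat i * g (p + 1) a d (i - 1) k c
     + of_nat p * (g p (a + 1) d i k c + g p a (d + 1) i k c)
     + of_nat a * g (p + 1) (a - 1) d i k c
     + of_nat d * g (p + 1) a (d - 1) i k c"

text \<open>
  What remains of \<open>cycle_insertion\<close> when only the number \<open>s\<close> of double ascents and double descents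
  together is recorded.
\<close>

definition merged_insertion ::
    "(nat \<Rightarrow> nat \<Rightarrow> nat \<Rightarrow> nat \<Rightarrow> 'a) \<Rightarrow> nat \<Rightarrow> nat \<Rightarrow> nat \<Rightarrow> nat \<Rightarrow> 'a::comm_semiring_1" where
  "merged_insertion h p s z c = h p s (z + 1) (c + 1)
     + of_nat z * h (p + 1) s (z - 1) c
     + of_nat p * h p (s + 1) z c
     + of_nat (2 * s) * h (p + 1) (s - 1) z c"

lemma binomial_sum_word_insertion:
  "binomial_sum z (\<lambda>i k. word_insertion g p a d i k c)
   = cycle_insertion (\<lambda>p a d z c. binomial_sum z (\<lambda>i k. g p a d i k c)) p a d z c"
  by (simp add: word_insertion_def cycle_insertion_def binomial_sum_add binomial_sum_cmult
      binomial_sum_Suc binomial_sum_left_deriv[of z "\<lambda>i k. g (Suc p) a d i k c", simplified] ac_simps)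

lemma binomial_sum_cycle_insertion:
  "binomial_sum s (\<lambda>a d. cycle_insertion f p a d z c)
   = merged_insertion (\<lambda>p s z c. binomial_sum s (\<lambda>a d. f p a d z c)) p s z c"
  by (simp add: merged_insertion_def cycle_insertion_def binomial_sum_add binomial_sum_cmult
      binomial_sum_Suc binomial_sum_left_deriv[of s "\<lambda>a d. f (Suc p) a d z c", simplified]
       binomial_sum_right_deriv[of s "\<lambda>a d. f (Suc p) a d z c", simplified]
       mult_2 distrib_right distrib_left ac_simps)

text \<open>
  The total of \<open>h\<close> over all outcomes of \<open>n\<close> insertions, starting from the empty permutation.
\<close>

fun merged_total :: "nat \<Rightarrow> (nat \<Rightarrow> nat \<Rightarrow> nat \<Rightarrow> nat \<Rightarrow> 'a::comm_semiring_1) \<Rightarrow> 'a" where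
  "merged_total 0 h = h 0 0 0 0"
| "merged_total (Suc n) h = merged_total n (merged_insertion h)"

text \<open>
  Every insertion raises \<open>2 p + s + z\<close> by one, so after \<open>n\<close> insertions only arguments with
  \<open>2 p + s + z = n\<close> occur. The truncated subtractions in \<open>merged_insertion\<close> would violate this, but
  they carry a vanishing coefficient.
\<close>

lemma merged_total_cong:
  assumes "\<And>p s z c. 2 * p + s + z = n \<Longrightarrow> h p s z c = h' p s z c"
  shows "merged_total n h = merged_total n h'"
  using assms
proof (induction n arbitrary: h h')
  case (Suc n)
  have "merged_insertion h p s z c = merged_insertion h' p s z c" if "2 * p + s + z = n" for p s z c
  proof -
    have "of_nat z * h (p + 1) s (z - 1) c = of_nat z * h' (p + 1) s (z - 1) c"
      using that Suc.prems[of "p + 1" s "z - 1" c] by (cases z) auto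
    moreover have "of_nat (2 * s) * h (p + 1) (s - 1) z c = of_nat (2 * s) * h' (p + 1) (s - 1) z c"
      using that Suc.prems[of "p + 1" "s - 1" z c] by (cases s) auto
    ultimately show ?thesis
      using that by (simp add: merged_insertion_def Suc.prems)
  qed
  then show ?case by (simp only: merged_total.simps Suc.IH[of "merged_insertion h" "merged_insertion h'"])
qed simp

lemma merged_total_sum:
  "merged_total n (\<lambda>p s z c. \<Sum>j\<in>J. h j p s z c * w j) = (\<Sum>j\<in>J. merged_total n (h j) * w j)"
proof (induction n arbitrary: h)
  case (Suc n)
  have "merged_insertion (\<lambda>p s z c. \<Sum>j\<in>J. h j p s z c * w j)
      = (\<lambda>p s z c. \<Sum>j\<in>J. merged_insertion (h j) p s z c * w j)"
    by (intro ext) (simp add: merged_insertion_def sum_distrib_left sum.distrib distrib_right mult.assoc)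
  then show ?case by (simp add: Suc.IH)
qed simp

section \<open>Permutations of an initial segment\<close>

lemma SymD: "\<sigma> \<in> Sym n \<Longrightarrow> \<sigma> permutes {1..n}" by (simp add: Sym_def)

lemma Sym_in_range: "\<sigma> \<in> Sym m \<Longrightarrow> i \<in> {1..m} \<Longrightarrow> \<sigma> i \<in> {1..m}"
  using permutes_in_image[OF SymD] by blast

lemma Sym_inj: "\<sigma> \<in> Sym m \<Longrightarrow> \<sigma> i = \<sigma> j \<longleftrightarrow> i = j"
  using permutes_inj[OF SymD] by (metis injD)

lemma finite_Sym [simp]: "finite (Sym m)"
  by (simp add: Sym_def finite_permutations)

section \<open>Insertion of the largest element into a cycle\<close>

definition cyclic_peaks :: "nat \<Rightarrow> (nat \<Rightarrow> nat) \<Rightarrow> nat set" where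
  "cyclic_peaks n \<sigma> = {i \<in> {1..n}. inv \<sigma> i < i \<and> i > \<sigma> i}"
definition cyclic_double_ascents :: "nat \<Rightarrow> (nat \<Rightarrow> nat) \<Rightarrow> nat set" where
  "cyclic_double_ascents n \<sigma> = {i \<in> {1..n}. inv \<sigma> i < i \<and> i < \<sigma> i}"
definition cyclic_double_descents :: "nat \<Rightarrow> (nat \<Rightarrow> nat) \<Rightarrow> nat set" where
  "cyclic_double_descents n \<sigma> = {i \<in> {1..n}. inv \<sigma> i > i \<and> i > \<sigma> i}"
definition fixed_points :: "nat \<Rightarrow> (nat \<Rightarrow> nat) \<Rightarrow> nat set" where
  "fixed_points n \<sigma> = {i \<in> {1..n}. \<sigma> i = i}"

lemmas cyclic_set_defs =
  cyclic_peaks_def cyclic_double_ascents_def cyclic_double_descents_def fixed_points_def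

lemma drops_eq: "drops n \<sigma> = cpk n \<sigma> + cdd n \<sigma>" if "\<sigma> \<in> Sym n"
proof -
  have eq: "{i \<in> {1..n}. i > \<sigma> i} = cyclic_peaks n \<sigma> \<union> cyclic_double_descents n \<sigma>"
  proof (rule set_eqI)
    fix i
    have "inv \<sigma> i = i \<longleftrightarrow> \<sigma> i = i" using permutes_inverses[OF SymD[OF that]] by metis
    then show "i \<in> {i \<in> {1..n}. i > \<sigma> i} \<longleftrightarrow> i \<in> cyclic_peaks n \<sigma> \<union> cyclic_double_descents n \<sigma>"
      by (auto simp: cyclic_peaks_def cyclic_double_descents_def)
  qed
  have "card (cyclic_peaks n \<sigma> \<union> cyclic_double_descents n \<sigma>)
      = card (cyclic_peaks n \<sigma>) + card (cyclic_double_descents n \<sigma>)"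
    by (rule card_Un_disjoint) (auto simp: cyclic_peaks_def cyclic_double_descents_def)
  then show ?thesis
    unfolding drops_def eq by (simp add: cpk_def cdd_def cyclic_peaks_def cyclic_double_descents_def)
qed

text \<open>
  The values \<open>b = \<sigma> i\<close> of excedances are exactly the \<open>b\<close> entered from below, that is, the cyclic
  peaks and the cyclic double ascents.
\<close>

lemma exc_eq: "exc n \<sigma> = cpk n \<sigma> + cda n \<sigma>" if "\<sigma> \<in> Sym n"
proof -
  note perm = SymD[OF that]
  note inv = permutes_inverses[OF perm]
  have img: "\<sigma> ` {i \<in> {1..n}. i < \<sigma> i} = {b \<in> {1..n}. inv \<sigma> b < b}"
  proof (intro equalityI subsetI)
    fix b assume "b \<in> {b \<in> {1..n}. inv \<sigma> b < b}"
    then have "inv \<sigma> b \<in> {i \<in> {1..n}. i < \<sigma> i}"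
      using permutes_in_image[OF permutes_inv[OF perm], of b] inv by simp
    then have "\<sigma> (inv \<sigma> b) \<in> \<sigma> ` {i \<in> {1..n}. i < \<sigma> i}" by (rule imageI)
    then show "b \<in> \<sigma> ` {i \<in> {1..n}. i < \<sigma> i}" by (simp only: inv(1))
  next
    fix b assume "b \<in> \<sigma> ` {i \<in> {1..n}. i < \<sigma> i}"
    then obtain i where i: "i \<in> {1..n}" "i < \<sigma> i" "b = \<sigma> i" by blast
    then have "b \<in> {1..n}" "inv \<sigma> b = i" using Sym_in_range[OF that i(1)] inv(2) by simp_all
    then show "b \<in> {b \<in> {1..n}. inv \<sigma> b < b}" using i by simp
  qed
  have "inj_on \<sigma> {i \<in> {1..n}. i < \<sigma> i}"
    using permutes_inj[OF perm] by (rule inj_on_subset) simp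
  from card_image[OF this] have "exc n \<sigma> = card {b \<in> {1..n}. inv \<sigma> b < b}"
    unfolding exc_def img ..
  also have "{b \<in> {1..n}. inv \<sigma> b < b} = cyclic_peaks n \<sigma> \<union> cyclic_double_ascents n \<sigma>"
  proof (rule set_eqI)
    fix i
    have "inv \<sigma> i = i \<longleftrightarrow> \<sigma> i = i" using inv by metis
    then show "i \<in> {b \<in> {1..n}. inv \<sigma> b < b} \<longleftrightarrow> i \<in> cyclic_peaks n \<sigma> \<union> cyclic_double_ascents n \<sigma>"
      by (auto simp: cyclic_peaks_def cyclic_double_ascents_def)
  qed
  also have "card \<dots> = card (cyclic_peaks n \<sigma>) + card (cyclic_double_ascents n \<sigma>)"
    by (rule card_Un_disjoint) (auto simp: cyclic_peaks_def cyclic_double_ascents_def)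
  finally show ?thesis
    by (simp add: cpk_def cda_def cyclic_peaks_def cyclic_double_ascents_def)
qed

text \<open>
  Composing with \<open>transpose (n + 1) b\<close> splices \<open>n + 1\<close> into the arc of \<open>\<sigma>\<close> that ends in \<open>b\<close>.
\<close>

lemma sum_Sym_Suc:
  "(\<Sum>\<tau>\<in>Sym (Suc n). G \<tau>) = (\<Sum>\<sigma>\<in>Sym n. G \<sigma> + (\<Sum>b=1..n. G (transpose (Suc n) b \<circ> \<sigma>)))"
proof -
  have "(\<Sum>\<tau>\<in>Sym (Suc n). G \<tau>)
      = (\<Sum>b\<in>insert (Suc n) {1..n}. \<Sum>\<sigma>\<in>Sym n. G (transpose (Suc n) b \<circ> \<sigma>))"
  proof -
    have "{1..Suc n} = insert (Suc n) {1..n}" by auto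
    then show ?thesis
      unfolding Sym_def by (simp only:) (rule sum_over_permutations_insert; simp)
  qed
  also have "\<dots> = (\<Sum>\<sigma>\<in>Sym n. \<Sum>b\<in>insert (Suc n) {1..n}. G (transpose (Suc n) b \<circ> \<sigma>))"
    by (rule sum.swap)
  finally show ?thesis by simp
qed

text \<open>
  Splicing a fixed point \<open>a\<close> into an arc only delays the walk along that arc, so an orbit changes
  at most by acquiring \<open>a\<close>.
\<close>

lemma orbit_insert_inter:
  assumes a: "\<sigma> a = a" and x: "x \<noteq> a" and b: "b \<noteq> a"
    and perm: "\<sigma> permutes S"
  shows "orbit (transpose a b \<circ> \<sigma>) x - {a} = orbit \<sigma> x"
proof -
  let ?\<tau> = "transpose a b \<circ> \<sigma>"
  have inj: "inj \<sigma>" using perm by (rule permutes_inj)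
  have ne: "\<sigma> y \<noteq> a" if "y \<noteq> a" for y using that a inj by (metis injD)
  have \<tau>a: "?\<tau> a = b" by (simp add: a)
  have \<tau>: "?\<tau> y = (if \<sigma> y = b then a else \<sigma> y)" if "y \<noteq> a" for y
    using ne[OF that] by (auto simp: transpose_def)
  have fwd: "y \<noteq> a \<and> y \<in> orbit ?\<tau> x" if "y \<in> orbit \<sigma> x" for y
    using that
  proof induction
    case base
    show ?case
      using \<tau>[OF x] \<tau>a ne[OF x] by (metis orbit.base orbit.step)
  next
    case (step y)
    then show ?case
      using \<tau>[of y] \<tau>a ne[of y] by (metis orbit.step)
  qed
  \<comment> \<open>The detour point \<open>a\<close> is identified with \<open>b\<close>, the point it leads to.\<close>
  have bwd: "(if y = a then b else y) \<in> orbit \<sigma> x" if "y \<in> orbit ?\<tau> x" for y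
    using that
  proof induction
    case base
    show ?case
      using \<tau>[OF x] ne[OF x] by (metis orbit.base)
  next
    case (step y)
    then show ?case
      using \<tau>[of y] \<tau>a ne[of y] b by (metis orbit.step)
  qed
  show ?thesis
  proof (intro equalityI subsetI)
    fix y assume "y \<in> orbit ?\<tau> x - {a}"
    then show "y \<in> orbit \<sigma> x" using bwd[of y] by simp
  next
    fix y assume "y \<in> orbit \<sigma> x"
    then show "y \<in> orbit ?\<tau> x - {a}" using fwd[of y] by blast
  qed
qed

lemma cyc_insert_new_cycle:
  assumes "\<sigma> \<in> Sym n"
  shows "cyc (Suc n) \<sigma> = cyc n \<sigma> + 1"
proof -
  have perm: "\<sigma> permutes {1..n}" using assms by (rule SymD)
  have fixN: "\<sigma> (Suc n) = Suc n" using perm by (simp add: permutes_def)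
  have orbN: "orbit \<sigma> (Suc n) = {Suc n}" using fixN by (simp add: orbit_eq_singleton_iff)
  have "Suc n \<notin> orbit \<sigma> x" if "x \<in> {1..n}" for x
    using permutes_orbit_subset[OF perm that] by auto
  then have "orbit \<sigma> (Suc n) \<notin> orbit \<sigma> ` {1..n}"
    using orbN by (metis imageE insertI1)
  then show ?thesis
    by (simp add: cyc_def atLeastAtMostSuc_conv)
qed

text \<open>
  Deleting \<open>n + 1\<close> maps the new orbits onto the old ones by \<open>orbit_insert_inter\<close>. It is injective
  because orbits that share a point coincide, and every new orbit keeps a point of \<open>[n]\<close>.
\<close>

lemma cyc_insert_in_cycle:
  assumes "\<sigma> \<in> Sym n" and b: "b \<in> {1..n}"
  shows "cyc (Suc n) (transpose (Suc n) b \<circ> \<sigma>) = cyc n \<sigma>"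
proof -
  let ?N = "Suc n" and ?\<tau> = "transpose (Suc n) b \<circ> \<sigma>"
  have perm: "\<sigma> permutes {1..n}" using assms(1) by (rule SymD)
  have fixN: "\<sigma> ?N = ?N" using perm by (simp add: permutes_def)
  have perm': "?\<tau> permutes {1..Suc n}"
  proof (rule permutes_compose)
    show "\<sigma> permutes {1..Suc n}" using perm by (rule permutes_subset) auto
    show "transpose (Suc n) b permutes {1..Suc n}" using b by (intro permutes_swap_id) auto
  qed
  have pm: "permutation ?\<tau>" using perm' by (metis permutation_permutes finite_atLeastAtMost)
  have self: "x \<in> orbit ?\<tau> x" for x by (rule permutation_self_in_orbit[OF pm])
  have orbit_eq: "orbit ?\<tau> x = orbit ?\<tau> y" if "x \<in> orbit ?\<tau> y" for x y
    using that by (rule orbit_cyclic_eq3[OF cyclic_on_orbit'[OF pm]])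
  have inter: "orbit ?\<tau> x - {?N} = orbit \<sigma> x" if "x \<in> {1..n}" for x
    using that b by (intro orbit_insert_inter[OF fixN _ _ perm]) auto
  have "orbit ?\<tau> ?N = orbit ?\<tau> b"
  proof -
    have "b \<in> orbit ?\<tau> ?N" using orbit.base[of ?\<tau> ?N] fixN by simp
    then show ?thesis by (rule orbit_eq[symmetric])
  qed
  then have "orbit ?\<tau> ` {1..Suc n} = orbit ?\<tau> ` {1..n}"
    using b by (auto simp: atLeastAtMostSuc_conv)
  moreover have "card (orbit ?\<tau> ` {1..n}) = card ((\<lambda>C. C - {?N}) ` (orbit ?\<tau> ` {1..n}))"
  proof (rule card_image[symmetric], rule inj_onI)
    fix O1 O2
    assume O: "O1 \<in> orbit ?\<tau> ` {1..n}" "O2 \<in> orbit ?\<tau> ` {1..n}" "O1 - {?N} = O2 - {?N}"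
    then obtain x y where xy: "x \<in> {1..n}" "y \<in> {1..n}" "O1 = orbit ?\<tau> x" "O2 = orbit ?\<tau> y"
      by auto
    have "x \<in> O1 - {?N}" using xy self[of x] by simp
    then have "x \<in> orbit ?\<tau> y" using O(3) xy(4) by simp
    then have "orbit ?\<tau> x = orbit ?\<tau> y" by (rule orbit_eq)
    then show "O1 = O2" using xy(3,4) by simp
  qed
  moreover have "(\<lambda>C. C - {?N}) ` (orbit ?\<tau> ` {1..n}) = orbit \<sigma> ` {1..n}"
    by (simp add: image_image inter)
  ultimately show ?thesis by (simp add: cyc_def)
qed

definition cyclic_weight :: "(nat \<Rightarrow> nat \<Rightarrow> nat \<Rightarrow> nat \<Rightarrow> nat \<Rightarrow> 'a) \<Rightarrow> nat \<Rightarrow> (nat \<Rightarrow> nat) \<Rightarrow> 'a" where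
  "cyclic_weight f n \<sigma> = f (cpk n \<sigma>) (cda n \<sigma>) (cdd n \<sigma>) (fixs n \<sigma>) (cyc n \<sigma>)"

lemma cyclic_weight_alt:
  "cyclic_weight f n \<sigma> = f (card (cyclic_peaks n \<sigma>)) (card (cyclic_double_ascents n \<sigma>))
     (card (cyclic_double_descents n \<sigma>)) (card (fixed_points n \<sigma>)) (cyc n \<sigma>)"
  by (simp add: cyclic_weight_def cpk_def cda_def cdd_def fixs_def cyclic_set_defs)

lemma cyclic_weight_new_cycle:
  assumes "\<sigma> \<in> Sym n"
  shows "cyclic_weight f (Suc n) \<sigma>
    = f (cpk n \<sigma>) (cda n \<sigma>) (cdd n \<sigma>) (fixs n \<sigma> + 1) (cyc n \<sigma> + 1)"
proof -
  have perm: "\<sigma> permutes {1..n}" using assms by (rule SymD)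
  have fixN: "\<sigma> (Suc n) = Suc n" "inv \<sigma> (Suc n) = Suc n"
    using perm permutes_inv[OF perm] by (auto simp: permutes_def)
  have "cyclic_peaks (Suc n) \<sigma> = cyclic_peaks n \<sigma>"
    "cyclic_double_ascents (Suc n) \<sigma> = cyclic_double_ascents n \<sigma>"
    "cyclic_double_descents (Suc n) \<sigma> = cyclic_double_descents n \<sigma>"
    "fixed_points (Suc n) \<sigma> = insert (Suc n) (fixed_points n \<sigma>)"
    using fixN by (auto simp: cyclic_set_defs le_Suc_eq)
  moreover have "card (insert (Suc n) (fixed_points n \<sigma>)) = fixs n \<sigma> + 1"
    by (simp add: fixed_points_def fixs_def)
  ultimately show ?thesis
    unfolding cyclic_weight_alt
    by (simp only: cyc_insert_new_cycle[OF assms]) (simp add: cpk_def cda_def cdd_def cyclic_set_defs)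
qed

text \<open>
  Only three elements see new neighbours: \<open>i\<close> now maps up to \<open>n + 1\<close>, \<open>b\<close> is now entered from above,
  and \<open>n + 1\<close> is a cyclic peak.
\<close>

lemma cyclic_sets_insert_in_cycle:
  assumes "\<sigma> \<in> Sym n" and b: "b \<in> {1..n}" and i: "i = inv \<sigma> b"
  defines "\<tau> \<equiv> transpose (Suc n) b \<circ> \<sigma>"
  shows "cyclic_peaks (Suc n) \<tau> = insert (Suc n) (cyclic_peaks n \<sigma> - {b, i})"
    and "cyclic_double_ascents (Suc n) \<tau>
      = (cyclic_double_ascents n \<sigma> - {b}) \<union> (if inv \<sigma> i < i then {i} else {})"
    and "cyclic_double_descents (Suc n) \<tau>
      = (cyclic_double_descents n \<sigma> - {i}) \<union> (if \<sigma> b < b then {b} else {})"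
    and "fixed_points (Suc n) \<tau> = fixed_points n \<sigma> - {b}"
proof -
  have perm: "\<sigma> permutes {1..n}" using assms(1) by (rule SymD)
  have perm': "inv \<sigma> permutes {1..n}" by (rule permutes_inv[OF perm])
  have fixN: "\<sigma> (Suc n) = Suc n" "inv \<sigma> (Suc n) = Suc n"
    using perm perm' by (auto simp: permutes_def)
  have \<sigma>i: "\<sigma> i = b" "inv \<sigma> b = i" using permutes_inverses[OF perm] i by auto
  have inn: "i \<in> {1..n}" using permutes_in_image[OF perm'] b i by simp
  have rng: "\<sigma> x \<in> {1..n}" "inv \<sigma> x \<in> {1..n}" if "x \<in> {1..n}" for x
    using that permutes_in_image[OF perm] permutes_in_image[OF perm'] by auto
  have \<tau>: "\<tau> x = (if x = i then Suc n else if x = Suc n then b else \<sigma> x)" for x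
    using \<sigma>i fixN perm' perm b unfolding \<tau>_def transpose_def
    by (auto simp: permutes_inverses[OF perm]) (metis permutes_inverses)+
  have "inv \<tau> = inv \<sigma> \<circ> transpose (Suc n) b"
    unfolding \<tau>_def using permutes_bij[OF perm] by (simp add: o_inv_distrib)
  then have inv\<tau>: "inv \<tau> x = (if x = b then Suc n else if x = Suc n then i else inv \<sigma> x)" for x
    using \<sigma>i fixN by (auto simp: transpose_def)
  have eq: "\<sigma> x = b \<longleftrightarrow> x = i" for x
    using permutes_inverses[OF perm] \<sigma>i by metis
  have bnd: "b \<noteq> Suc n" "i \<noteq> Suc n" "1 \<le> b" "b \<le> n" "1 \<le> i" "i \<le> n" "\<sigma> b \<le> n" "inv \<sigma> i \<le> n"
    using b inn rng[of b] rng[of i] by auto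
  note facts = \<tau> inv\<tau> \<sigma>i cyclic_set_defs le_Suc_eq
  show "cyclic_peaks (Suc n) \<tau> = insert (Suc n) (cyclic_peaks n \<sigma> - {b, i})"
  proof (rule set_eqI)
    fix x show "x \<in> cyclic_peaks (Suc n) \<tau> \<longleftrightarrow> x \<in> insert (Suc n) (cyclic_peaks n \<sigma> - {b, i})"
      using bnd \<sigma>i by (cases "x = Suc n"; cases "x = b"; cases "x = i") (simp_all add: facts)
  qed
  show "cyclic_double_ascents (Suc n) \<tau>
      = (cyclic_double_ascents n \<sigma> - {b}) \<union> (if inv \<sigma> i < i then {i} else {})"
    (is "?A = ?B")
  proof (rule set_eqI)
    fix x show "x \<in> ?A \<longleftrightarrow> x \<in> ?B"
      using bnd \<sigma>i by (cases "x = Suc n"; cases "x = b"; cases "x = i") (simp_all add: facts)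
  qed
  show "cyclic_double_descents (Suc n) \<tau>
      = (cyclic_double_descents n \<sigma> - {i}) \<union> (if \<sigma> b < b then {b} else {})"
    (is "?A = ?B")
  proof (rule set_eqI)
    fix x show "x \<in> ?A \<longleftrightarrow> x \<in> ?B"
      using bnd \<sigma>i by (cases "x = Suc n"; cases "x = b"; cases "x = i") (simp_all add: facts)
  qed
  show "fixed_points (Suc n) \<tau> = fixed_points n \<sigma> - {b}" (is "?A = ?B")
  proof (rule set_eqI)
    fix x show "x \<in> ?A \<longleftrightarrow> x \<in> ?B"
      using bnd \<sigma>i eq by (cases "x = Suc n"; cases "x = b"; cases "x = i") (simp_all add: facts)
  qed
qed

text \<open>
  The five types of arcs \<open>i \<mapsto> b\<close>. If the arc ascends, only \<open>b\<close> changes its type: a peak becomes a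
  double descent and a double ascent becomes a valley. If it descends, only \<open>i\<close> changes its type: a
  peak becomes a double ascent and a double descent becomes a valley. A fixed point, being both
  ends of its arc, becomes a valley. The new peak \<open>n + 1\<close> either
  replaces the lost one or is an additional one.
\<close>

lemma cyclic_weight_insert_in_cycle:
  fixes f :: "nat \<Rightarrow> nat \<Rightarrow> nat \<Rightarrow> nat \<Rightarrow> nat \<Rightarrow> 'a"
  assumes \<sigma>: "\<sigma> \<in> Sym n"
  defines "W \<equiv> \<lambda>b. cyclic_weight f (Suc n) (transpose (Suc n) b \<circ> \<sigma>)"
  shows "b \<in> fixed_points n \<sigma> \<Longrightarrow>
      W b = f (cpk n \<sigma> + 1) (cda n \<sigma>) (cdd n \<sigma>) (fixs n \<sigma> - 1) (cyc n \<sigma>)"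
    and "b \<in> cyclic_peaks n \<sigma> \<Longrightarrow>
      W b = f (cpk n \<sigma>) (cda n \<sigma>) (cdd n \<sigma> + 1) (fixs n \<sigma>) (cyc n \<sigma>)"
    and "b \<in> cyclic_double_ascents n \<sigma> \<Longrightarrow>
      W b = f (cpk n \<sigma> + 1) (cda n \<sigma> - 1) (cdd n \<sigma>) (fixs n \<sigma>) (cyc n \<sigma>)"
    and "b \<in> \<sigma> ` cyclic_peaks n \<sigma> \<Longrightarrow>
      W b = f (cpk n \<sigma>) (cda n \<sigma> + 1) (cdd n \<sigma>) (fixs n \<sigma>) (cyc n \<sigma>)"
    and "b \<in> \<sigma> ` cyclic_double_descents n \<sigma> \<Longrightarrow>
      W b = f (cpk n \<sigma> + 1) (cda n \<sigma>) (cdd n \<sigma> - 1) (fixs n \<sigma>) (cyc n \<sigma>)"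
proof -
  let ?P = "cyclic_peaks n \<sigma>" and ?A = "cyclic_double_ascents n \<sigma>"
    and ?D = "cyclic_double_descents n \<sigma>" and ?F = "fixed_points n \<sigma>"
  have perm: "\<sigma> permutes {1..n}" using \<sigma> by (rule SymD)
  note inv = permutes_inverses[OF perm]
  have fin: "finite ?P" "finite ?A" "finite ?D" "finite ?F"
    and N: "Suc n \<notin> ?P" by (auto simp: cyclic_set_defs)
  have cards: "cpk n \<sigma> = card ?P" "cda n \<sigma> = card ?A" "cdd n \<sigma> = card ?D" "fixs n \<sigma> = card ?F"
    by (simp_all add: cpk_def cda_def cdd_def fixs_def cyclic_set_defs)
  have W: "W b = f (card (insert (Suc n) (?P - {b, i})))
      (card ((?A - {b}) \<union> (if inv \<sigma> i < i then {i} else {})))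
      (card ((?D - {i}) \<union> (if \<sigma> b < b then {b} else {})))
      (card (?F - {b})) (cyc n \<sigma>)" if "b \<in> {1..n}" "i = inv \<sigma> b" for b i
    unfolding W_def cyclic_weight_alt cyclic_sets_insert_in_cycle[OF \<sigma> that]
      cyc_insert_in_cycle[OF \<sigma> that(1)] ..
  have fix_iff: "inv \<sigma> b = b \<longleftrightarrow> \<sigma> b = b" for b
    using inv by metis
  have rng: "\<sigma> x \<in> {1..n}" if "x \<in> {1..n}" for x
    using that permutes_in_image[OF perm] by auto
  {
    assume b: "b \<in> ?F"
    then have bn: "b \<in> {1..n}" and i: "inv \<sigma> b = b" "\<sigma> b = b"
      by (auto simp: fixed_points_def fix_iff)
    have "?P - {b, b} = ?P" "?A - {b} = ?A" "?D - {b} = ?D"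
      using i by (auto simp: cyclic_set_defs)
    then show "W b = f (cpk n \<sigma> + 1) (cda n \<sigma>) (cdd n \<sigma>) (fixs n \<sigma> - 1) (cyc n \<sigma>)"
      using W[OF bn refl] b i fin N by (simp add: cards)
  next
    assume b: "b \<in> ?P"
    define i where "i = inv \<sigma> b"
    have bn: "b \<in> {1..n}" and i: "i < b" "\<sigma> i = b" "\<sigma> b < b"
      using b by (auto simp: cyclic_peaks_def i_def inv)
    have "?P - {b, i} = ?P - {b}" "(?A - {b}) \<union> (if inv \<sigma> i < i then {i} else {}) = ?A"
      "(?D - {i}) \<union> (if \<sigma> b < b then {b} else {}) = insert b ?D" "?F - {b} = ?F" "b \<notin> ?D"
      using i b by (auto simp: cyclic_set_defs)
    moreover have "0 < card ?P" using b fin by (auto simp: card_gt_0_iff)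
    ultimately show "W b = f (cpk n \<sigma>) (cda n \<sigma>) (cdd n \<sigma> + 1) (fixs n \<sigma>) (cyc n \<sigma>)"
      using W[OF bn i_def] b fin N by (simp add: cards)
  next
    assume b: "b \<in> ?A"
    define i where "i = inv \<sigma> b"
    have bn: "b \<in> {1..n}" and i: "i < b" "\<sigma> i = b" "b < \<sigma> b"
      using b by (auto simp: cyclic_double_ascents_def i_def inv)
    have "?P - {b, i} = ?P" "(?A - {b}) \<union> (if inv \<sigma> i < i then {i} else {}) = ?A - {b}"
      "(?D - {i}) \<union> (if \<sigma> b < b then {b} else {}) = ?D" "?F - {b} = ?F"
      using i b by (auto simp: cyclic_set_defs)
    then show "W b = f (cpk n \<sigma> + 1) (cda n \<sigma> - 1) (cdd n \<sigma>) (fixs n \<sigma>) (cyc n \<sigma>)"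
      using W[OF bn i_def] b fin N by (simp add: cards)
  next
    assume "b \<in> \<sigma> ` ?P"
    then obtain i where iP: "i \<in> ?P" and b: "b = \<sigma> i" by auto
    have i: "i = inv \<sigma> b" "b < i" "inv \<sigma> i < i" "i \<in> {1..n}"
      using b iP inv by (auto simp: cyclic_peaks_def)
    have bn: "b \<in> {1..n}" using rng[OF i(4)] b by simp
    have nf: "\<sigma> b \<noteq> b" using i(1,2) fix_iff[of b] by simp
    have "?P - {b, i} = ?P - {i}" "(?A - {b}) \<union> (if inv \<sigma> i < i then {i} else {}) = insert i ?A"
      "(?D - {i}) \<union> (if \<sigma> b < b then {b} else {}) = ?D" "?F - {b} = ?F" "i \<notin> ?A"
      using i b nf by (auto simp: cyclic_set_defs)
    moreover have "0 < card ?P" using iP fin by (auto simp: card_gt_0_iff)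
    ultimately show "W b = f (cpk n \<sigma>) (cda n \<sigma> + 1) (cdd n \<sigma>) (fixs n \<sigma>) (cyc n \<sigma>)"
      using W[OF bn i(1)] iP fin N by (simp add: cards)
  next
    assume "b \<in> \<sigma> ` ?D"
    then obtain i where iD: "i \<in> ?D" and b: "b = \<sigma> i" by auto
    have i: "i = inv \<sigma> b" "b < i" "i < inv \<sigma> i" "i \<in> {1..n}"
      using b iD inv by (auto simp: cyclic_double_descents_def)
    have bn: "b \<in> {1..n}" using rng[OF i(4)] b by simp
    have nf: "\<sigma> b \<noteq> b" using i(1,2) fix_iff[of b] by simp
    have "?P - {b, i} = ?P" "(?A - {b}) \<union> (if inv \<sigma> i < i then {i} else {}) = ?A"
      "(?D - {i}) \<union> (if \<sigma> b < b then {b} else {}) = ?D - {i}" "?F - {b} = ?F"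
      using i b nf by (auto simp: cyclic_set_defs)
    then show "W b = f (cpk n \<sigma> + 1) (cda n \<sigma>) (cdd n \<sigma> - 1) (fixs n \<sigma>) (cyc n \<sigma>)"
      using W[OF bn i(1)] iD fin N by (simp add: cards)
  }
qed

text \<open>
  Ascending arcs are indexed by their upper end \<open>b\<close>, which is a peak or a double ascent. Descending
  arcs are indexed by their upper end as well, which is \<open>inv \<sigma> b\<close>; hence the images under \<open>\<sigma>\<close>.
\<close>

lemma cyclic_gap_partition:
  assumes "\<sigma> \<in> Sym n"
  shows "(\<Sum>b=1..n. G b) = sum G (fixed_points n \<sigma>) + sum G (cyclic_peaks n \<sigma>)
    + sum G (cyclic_double_ascents n \<sigma>) + sum G (\<sigma> ` cyclic_peaks n \<sigma>)
    + sum G (\<sigma> ` cyclic_double_descents n \<sigma>)"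
proof -
  let ?P = "cyclic_peaks n \<sigma>" and ?A = "cyclic_double_ascents n \<sigma>"
    and ?D = "cyclic_double_descents n \<sigma>" and ?F = "fixed_points n \<sigma>"
  have perm: "\<sigma> permutes {1..n}" using assms by (rule SymD)
  note inv = permutes_inverses[OF perm]
  have fin: "finite ?P" "finite ?A" "finite ?D" "finite ?F" by (auto simp: cyclic_set_defs)
  have img: "\<sigma> ` X = {b \<in> {1..n}. inv \<sigma> b \<in> X}" if "X \<subseteq> {1..n}" for X
  proof (rule set_eqI)
    fix b
    have "inv \<sigma> b \<in> X \<longleftrightarrow> b \<in> \<sigma> ` X" using inv by (metis imageE imageI)
    moreover have "b \<in> {1..n}" if "b \<in> \<sigma> ` X"
      using that \<open>X \<subseteq> {1..n}\<close> permutes_image[OF perm] by blast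
    ultimately show "b \<in> \<sigma> ` X \<longleftrightarrow> b \<in> {b \<in> {1..n}. inv \<sigma> b \<in> X}" by blast
  qed
  have fix_iff: "inv \<sigma> b = b \<longleftrightarrow> \<sigma> b = b" for b using inv by metis
  have sub: "?P \<subseteq> {1..n}" "?D \<subseteq> {1..n}" by (auto simp: cyclic_set_defs)
  have mem: "inv \<sigma> b \<in> ?P \<longleftrightarrow> b < inv \<sigma> b \<and> inv \<sigma> (inv \<sigma> b) < inv \<sigma> b"
    "inv \<sigma> b \<in> ?D \<longleftrightarrow> b < inv \<sigma> b \<and> inv \<sigma> b < inv \<sigma> (inv \<sigma> b)" if "b \<in> {1..n}" for b
    using that permutes_in_image[OF permutes_inv[OF perm], of b]
    by (auto simp: cyclic_set_defs inv)
  have imgP: "\<sigma> ` ?P = {b \<in> {1..n}. b < inv \<sigma> b \<and> inv \<sigma> (inv \<sigma> b) < inv \<sigma> b}"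
    unfolding img[OF sub(1)] using mem(1) by blast
  have imgD: "\<sigma> ` ?D = {b \<in> {1..n}. b < inv \<sigma> b \<and> inv \<sigma> b < inv \<sigma> (inv \<sigma> b)}"
    unfolding img[OF sub(2)] using mem(2) by blast
  have ne: "inv \<sigma> (inv \<sigma> b) \<noteq> inv \<sigma> b" if "inv \<sigma> b \<noteq> b" for b
    using that inv by metis
  have "{1..n} = ?F \<union> ?P \<union> ?A \<union> \<sigma> ` ?P \<union> \<sigma> ` ?D"
  proof (rule set_eqI)
    fix b show "b \<in> {1..n} \<longleftrightarrow> b \<in> ?F \<union> ?P \<union> ?A \<union> \<sigma> ` ?P \<union> \<sigma> ` ?D"
      unfolding imgP imgD using ne[of b] fix_iff[of b]
      by (auto simp: cyclic_set_defs)
  qed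
  moreover have "?F \<inter> ?P = {}" "(?F \<union> ?P) \<inter> ?A = {}"
    "(?F \<union> ?P \<union> ?A) \<inter> \<sigma> ` ?P = {}" "(?F \<union> ?P \<union> ?A \<union> \<sigma> ` ?P) \<inter> \<sigma> ` ?D = {}"
    unfolding imgP imgD by (auto simp: cyclic_set_defs fix_iff[symmetric])
  ultimately show ?thesis
    using fin by (simp add: sum.union_disjoint)
qed

lemma sum_cyclic_weight_Suc:
  fixes f :: "nat \<Rightarrow> nat \<Rightarrow> nat \<Rightarrow> nat \<Rightarrow> nat \<Rightarrow> 'a::comm_semiring_1"
  shows "(\<Sum>\<tau>\<in>Sym (Suc n). cyclic_weight f (Suc n) \<tau>)
    = (\<Sum>\<sigma>\<in>Sym n. cyclic_weight (cycle_insertion f) n \<sigma>)"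
  unfolding sum_Sym_Suc
proof (rule sum.cong[OF refl])
  fix \<sigma> assume \<sigma>: "\<sigma> \<in> Sym n"
  let ?P = "cyclic_peaks n \<sigma>" and ?A = "cyclic_double_ascents n \<sigma>"
    and ?D = "cyclic_double_descents n \<sigma>" and ?F = "fixed_points n \<sigma>"
  have inj: "inj_on \<sigma> X" for X
    using permutes_inj[OF SymD[OF \<sigma>]] by (rule inj_on_subset) simp
  have cards: "card ?P = cpk n \<sigma>" "card ?A = cda n \<sigma>" "card ?D = cdd n \<sigma>" "card ?F = fixs n \<sigma>"
    by (simp_all add: cpk_def cda_def cdd_def fixs_def cyclic_set_defs)
  let ?W = "\<lambda>b. cyclic_weight f (Suc n) (transpose (Suc n) b \<circ> \<sigma>)"
  note w = cyclic_weight_insert_in_cycle[OF \<sigma>, of _ f]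
  have const: "sum ?W X = of_nat (card X) * k" if "\<And>b. b \<in> X \<Longrightarrow> ?W b = k" for X k
    using that by simp
  let ?v = "\<lambda>p a d z. f p a d z (cyc n \<sigma>)"
  have sums:
    "sum ?W ?F = of_nat (card ?F) * ?v (cpk n \<sigma> + 1) (cda n \<sigma>) (cdd n \<sigma>) (fixs n \<sigma> - 1)"
    "sum ?W ?P = of_nat (card ?P) * ?v (cpk n \<sigma>) (cda n \<sigma>) (cdd n \<sigma> + 1) (fixs n \<sigma>)"
    "sum ?W ?A = of_nat (card ?A) * ?v (cpk n \<sigma> + 1) (cda n \<sigma> - 1) (cdd n \<sigma>) (fixs n \<sigma>)"
    "sum ?W (\<sigma> ` ?P) = of_nat (card (\<sigma> ` ?P)) * ?v (cpk n \<sigma>) (cda n \<sigma> + 1) (cdd n \<sigma>) (fixs n \<sigma>)"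
    "sum ?W (\<sigma> ` ?D) = of_nat (card (\<sigma> ` ?D)) * ?v (cpk n \<sigma> + 1) (cda n \<sigma>) (cdd n \<sigma> - 1) (fixs n \<sigma>)"
    by (rule const, erule w)+
  show "cyclic_weight f (Suc n) \<sigma> + (\<Sum>b=1..n. cyclic_weight f (Suc n) (transpose (Suc n) b \<circ> \<sigma>))
      = cyclic_weight (cycle_insertion f) n \<sigma>"
    unfolding cyclic_gap_partition[OF \<sigma>] cyclic_weight_new_cycle[OF \<sigma>] sums card_image[OF inj] cards
    by (simp add: cyclic_weight_def cycle_insertion_def distrib_left ac_simps)
qed

section \<open>Rises and falls of a word\<close>

text \<open>
  All types of letters are determined by the rises at positions \<open>0, \<dots>, m\<close>, which include the two
  steps from and to the surrounding zeros. Inserting a letter only edits this sequence locally.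
\<close>

definition rises :: "nat \<Rightarrow> (nat \<Rightarrow> nat) \<Rightarrow> nat \<Rightarrow> bool" where
  "rises m \<sigma> i \<longleftrightarrow> letter m \<sigma> i < letter m \<sigma> (i + 1)"

lemma letter_neq_next:
  assumes "\<sigma> \<in> Sym m" "m \<ge> 1" "i \<le> m"
  shows "letter m \<sigma> i \<noteq> letter m \<sigma> (i + 1)"
  using assms Sym_in_range[OF assms(1), of i] Sym_in_range[OF assms(1), of "i + 1"] Sym_inj[OF assms(1), of i "i + 1"]
  by (auto simp: letter_def not_less_eq_eq le_less_Suc_eq)

lemma rises_0: "\<sigma> \<in> Sym m \<Longrightarrow> m \<ge> 1 \<Longrightarrow> rises m \<sigma> 0"
  using Sym_in_range[of \<sigma> m 1] by (auto simp: rises_def letter_def)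

lemma not_rises_last: "\<not> rises m \<sigma> m"
  by (auto simp: rises_def letter_def)

lemma rises_iff: "1 \<le> i \<Longrightarrow> i < m \<Longrightarrow> rises m \<sigma> i \<longleftrightarrow> \<sigma> i < \<sigma> (i + 1)"
  by (auto simp: rises_def letter_def)

definition valleys :: "nat \<Rightarrow> (nat \<Rightarrow> nat) \<Rightarrow> nat set" where
  "valleys m \<sigma> = {i \<in> {1..m}. \<not> rises m \<sigma> (i - 1) \<and> rises m \<sigma> i}"

text \<open>
  Neighbouring letters differ, so that a step which is not a rise is a fall.
\<close>

lemma
  assumes "\<sigma> \<in> Sym m"
  shows peaks_rises: "peaks m \<sigma> = {i \<in> {1..m}. rises m \<sigma> (i - 1) \<and> \<not> rises m \<sigma> i}"
    and double_ascents_rises: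
      "double_ascents m \<sigma> = {i \<in> {1..m}. rises m \<sigma> (i - 1) \<and> rises m \<sigma> i}"
    and double_descents_rises:
      "double_descents m \<sigma> = {i \<in> {1..m}. \<not> rises m \<sigma> (i - 1) \<and> \<not> rises m \<sigma> i}"
proof -
  have "letter m \<sigma> (i - 1) \<noteq> letter m \<sigma> i" "letter m \<sigma> i \<noteq> letter m \<sigma> (i + 1)"
    if "i \<in> {1..m}" for i
    using that letter_neq_next[OF assms, of "i - 1"] letter_neq_next[OF assms, of i] by (cases i; auto)+
  then have less: "letter m \<sigma> i < letter m \<sigma> (i - 1) \<longleftrightarrow> \<not> rises m \<sigma> (i - 1)"
    "letter m \<sigma> (i - 1) < letter m \<sigma> i \<longleftrightarrow> rises m \<sigma> (i - 1)"
    "letter m \<sigma> (i + 1) < letter m \<sigma> i \<longleftrightarrow> \<not> rises m \<sigma> i"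
    "letter m \<sigma> i < letter m \<sigma> (i + 1) \<longleftrightarrow> rises m \<sigma> i"
    if "i \<in> {1..m}" for i
    using that by (auto simp: rises_def) (metis nat_neq_iff One_nat_def)+
  show "peaks m \<sigma> = {i \<in> {1..m}. rises m \<sigma> (i - 1) \<and> \<not> rises m \<sigma> i}"
    "double_ascents m \<sigma> = {i \<in> {1..m}. rises m \<sigma> (i - 1) \<and> rises m \<sigma> i}"
    "double_descents m \<sigma> = {i \<in> {1..m}. \<not> rises m \<sigma> (i - 1) \<and> \<not> rises m \<sigma> i}"
    unfolding peaks_def double_ascents_def double_descents_def
    by (intro Collect_cong conj_cong refl; simp only: less)+
qed

text \<open>
  Falls are counted twice, once by their left and once by their right end. The left ends are peaks
  and double descents, and include the final fall to 0; the right ends are valleys and double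
  descents within the word. Comparing the counts gives one more peak than there are valleys.
\<close>

lemma
  assumes \<sigma>: "\<sigma> \<in> Sym m" and m: "m \<ge> 1"
  shows card_valleys: "pk m \<sigma> = card (valleys m \<sigma>) + 1"
    and des_eq: "des m \<sigma> = dd m \<sigma> + card (valleys m \<sigma>)"
    and asc_eq: "asc m \<sigma> = da m \<sigma> + card (valleys m \<sigma>)"
proof -
  let ?r = "rises m \<sigma>"
  have des: "des m \<sigma> = card {i \<in> {1..<m}. \<not> ?r i}"
  proof -
    have "\<sigma> (i + 1) < \<sigma> i \<longleftrightarrow> \<not> ?r i" if "i \<in> {1..<m}" for i
      using that Sym_inj[OF \<sigma>, of i "i + 1"] by (auto simp: rises_iff)
    then show ?thesis unfolding des_def by (metis (no_types, lifting) Collect_cong)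
  qed
  have asc: "asc m \<sigma> = card {i \<in> {1..<m}. ?r i}"
    unfolding asc_def by (rule arg_cong[of _ _ card]) (auto simp: rises_iff)
  have split: "card {i \<in> {1..m}. P i \<and> Q i} + card {i \<in> {1..m}. P i \<and> \<not> Q i} = card {i \<in> {1..m}. P i}"
    for P Q
    by (subst card_Un_disjoint[symmetric]) (auto intro: arg_cong[of _ _ card])
  have "{i \<in> {1..m}. \<not> ?r i} = insert m {i \<in> {1..<m}. \<not> ?r i}"
    using m not_rises_last by auto
  then have 1: "card {i \<in> {1..m}. \<not> ?r i} = des m \<sigma> + 1"
    by (simp add: des)
  have "{i \<in> {1..m}. \<not> ?r (i - 1)} = Suc ` {i \<in> {1..<m}. \<not> ?r i}" (is "?X = ?Y")
  proof (rule set_eqI)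
    fix x show "x \<in> ?X \<longleftrightarrow> x \<in> ?Y"
      using rises_0[OF \<sigma> m] by (cases x; cases "x - 1") (auto simp: image_iff)
  qed
  then have 2: "card {i \<in> {1..m}. \<not> ?r (i - 1)} = des m \<sigma>"
    by (simp add: des card_image)
  have "{i \<in> {1..m}. ?r i} = {i \<in> {1..<m}. ?r i}"
    using not_rises_last[of m \<sigma>] by (auto simp: less_le)
  then have 3: "card {i \<in> {1..m}. ?r i} = asc m \<sigma>"
    by (simp add: asc)
  have pk: "pk m \<sigma> = card {i \<in> {1..m}. \<not> ?r i \<and> ?r (i - 1)}"
    and dd: "dd m \<sigma> = card {i \<in> {1..m}. \<not> ?r i \<and> \<not> ?r (i - 1)}"
      "dd m \<sigma> = card {i \<in> {1..m}. \<not> ?r (i - 1) \<and> \<not> ?r i}"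
    and da: "da m \<sigma> = card {i \<in> {1..m}. ?r i \<and> ?r (i - 1)}"
    and v: "card (valleys m \<sigma>) = card {i \<in> {1..m}. \<not> ?r (i - 1) \<and> ?r i}"
     "card (valleys m \<sigma>) = card {i \<in> {1..m}. ?r i \<and> \<not> ?r (i - 1)}"
    unfolding pk_def dd_def da_def valleys_def
      peaks_rises[OF \<sigma>] double_ascents_rises[OF \<sigma>] double_descents_rises[OF \<sigma>]
    by (metis (no_types, lifting))+
  show "des m \<sigma> = dd m \<sigma> + card (valleys m \<sigma>)"
    using split[of "\<lambda>i. \<not> ?r (i - 1)" ?r] 2 dd v by linarith
  then show "pk m \<sigma> = card (valleys m \<sigma>) + 1"
    using split[of "\<lambda>i. \<not> ?r i" "\<lambda>i. ?r (i - 1)"] 1 dd pk by linarith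
  show "asc m \<sigma> = da m \<sigma> + card (valleys m \<sigma>)"
    using split[of ?r "\<lambda>i. ?r (i - 1)"] 3 da v by linarith
qed

lemma word_statistic_sets_finite [simp]:
  "finite (peaks m \<sigma>)" "finite (double_ascents m \<sigma>)" "finite (double_descents m \<sigma>)"
  "finite (lr_maxima m \<sigma>)" "finite (rl_maxima m \<sigma>)" "finite (valleys m \<sigma>)"
  by (simp_all add: peaks_def double_ascents_def double_descents_def lr_maxima_def rl_maxima_def
      valleys_def)

lemma da_split: "da m \<sigma> = card (double_ascents m \<sigma> - lr_maxima m \<sigma>) + lmaxda m \<sigma>"
  unfolding da_def lmaxda_def
  by (subst card_Un_disjoint[symmetric]) (auto intro: arg_cong[of _ _ card])

lemma dd_split: "dd m \<sigma> = card (double_descents m \<sigma> - rl_maxima m \<sigma>) + rmaxdd m \<sigma>"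
  unfolding dd_def rmaxdd_def
  by (subst card_Un_disjoint[symmetric]) (auto intro: arg_cong[of _ _ card])

section \<open>Insertion of the smallest letter into a word\<close>

text \<open>
  The position to which position \<open>i\<close> moves when a letter is inserted at position \<open>k\<close>.
\<close>

definition skip :: "nat \<Rightarrow> nat \<Rightarrow> nat" where
  "skip k i = (if i < k then i else i + 1)"

definition insert_min :: "nat \<Rightarrow> nat \<Rightarrow> (nat \<Rightarrow> nat) \<Rightarrow> nat \<Rightarrow> nat" where
  "insert_min m k \<sigma> i =
     (if i = k then 1
      else if i \<in> {1..m + 1} then \<sigma> (if i < k then i else i - 1) + 1
      else i)"

lemma inj_skip: "inj (skip k)"
  by (auto simp: inj_def skip_def split: if_splits)

lemma skip_neq [simp]: "skip k i \<noteq> k"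
  by (simp add: skip_def)

lemma skip_less_iff [simp]: "skip k i < skip k j \<longleftrightarrow> i < j"
  by (auto simp: skip_def)

lemma skip_in: "1 \<le> k \<Longrightarrow> i \<in> {1..m} \<Longrightarrow> skip k i \<in> {1..m + 1}"
  by (auto simp: skip_def)

lemma skip_cases:
  assumes "x \<in> {1..m + 1}" "k \<in> {1..m + 1}"
  obtains "x = k" | i where "i \<in> {1..m}" "x = skip k i"
proof (cases "x = k")
  case False
  show ?thesis
  proof (rule that(2)[of "if x < k then x else x - 1"])
    show "(if x < k then x else x - 1) \<in> {1..m}" using assms False by auto
    show "x = skip k (if x < k then x else x - 1)" using False by (auto simp: skip_def)
  qed
qed (use that in blast)

lemma insert_min_at [simp]: "insert_min m k \<sigma> k = 1"
  by (simp add: insert_min_def)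

lemma insert_min_skip: "k \<in> {1..m + 1} \<Longrightarrow> i \<in> {1..m} \<Longrightarrow> insert_min m k \<sigma> (skip k i) = \<sigma> i + 1"
  by (auto simp: insert_min_def skip_def)

lemma insert_min_Sym:
  assumes \<sigma>: "\<sigma> \<in> Sym m" and k: "k \<in> {1..m + 1}"
  shows "insert_min m k \<sigma> \<in> Sym (m + 1)"
proof -
  let ?\<tau> = "insert_min m k \<sigma>"
  have val: "if x = k then ?\<tau> x = 1
      else \<exists>i\<in>{1..m}. x = skip k i \<and> ?\<tau> x = \<sigma> i + 1 \<and> \<sigma> i \<in> {1..m}"
    if "x \<in> {1..m + 1}" for x
    using skip_cases[OF that k] insert_min_skip[OF k] insert_min_at Sym_in_range[OF \<sigma>] by metis
  have "inj_on ?\<tau> {1..m + 1}"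
  proof (rule inj_onI)
    fix x y assume xy: "x \<in> {1..m + 1}" "y \<in> {1..m + 1}" "?\<tau> x = ?\<tau> y"
    show "x = y"
      using val[OF xy(1)] val[OF xy(2)] xy(3)
      by (cases "x = k"; cases "y = k") (auto simp: Sym_inj[OF \<sigma>])
  qed
  moreover have "?\<tau> ` {1..m + 1} \<subseteq> {1..m + 1}"
  proof (rule image_subsetI)
    fix x assume "x \<in> {1..m + 1}"
    then show "?\<tau> x \<in> {1..m + 1}"
      using val[of x] by (cases "x = k") auto
  qed
  ultimately have "bij_betw ?\<tau> {1..m + 1} {1..m + 1}"
    by (simp add: bij_betw_def endo_inj_surj)
  moreover have "?\<tau> x = x" if "x \<notin> {1..m + 1}" for x
    using that k by (auto simp: insert_min_def)
  ultimately show ?thesis unfolding Sym_def by (auto intro: bij_imp_permutes)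
qed

lemma Sym_insert_min_exists:
  assumes \<tau>: "\<tau> \<in> Sym (m + 1)"
  obtains k \<sigma> where "k \<in> {1..m + 1}" "\<sigma> \<in> Sym m" "\<tau> = insert_min m k \<sigma>"
proof -
  \<comment> \<open>Delete the letter 1 and lower the others.\<close>
  define k where "k = inv \<tau> 1"
  have \<tau>k: "\<tau> k = 1" unfolding k_def by (rule permutes_inverses[OF SymD[OF \<tau>]])
  have k: "k \<in> {1..m + 1}"
    using \<tau>k permutes_in_image[OF SymD[OF \<tau>], of k] by simp
  define \<sigma> where "\<sigma> i = (if i \<in> {1..m} then \<tau> (skip k i) - 1 else i)" for i
  have ge2: "\<tau> (skip k i) \<in> {2..m + 1}" if "i \<in> {1..m}" for i
  proof -
    have "\<tau> (skip k i) \<in> {1..m + 1}" using Sym_in_range[OF \<tau> skip_in] that k by simp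
    moreover have "\<tau> (skip k i) \<noteq> 1" using \<tau>k Sym_inj[OF \<tau>, of "skip k i" k] by simp
    ultimately show ?thesis by simp
  qed
  have "inj_on \<sigma> {1..m}"
  proof (rule inj_onI)
    fix i j assume ij: "i \<in> {1..m}" "j \<in> {1..m}" "\<sigma> i = \<sigma> j"
    then have "\<tau> (skip k i) = \<tau> (skip k j)"
      using ge2[of i] ge2[of j] by (simp add: \<sigma>_def) arith
    then show "i = j" using Sym_inj[OF \<tau>] inj_skip[of k] by (simp add: inj_eq)
  qed
  moreover have "\<sigma> ` {1..m} \<subseteq> {1..m}"
    using ge2 by (force simp: \<sigma>_def)
  ultimately have "bij_betw \<sigma> {1..m} {1..m}"
    by (simp add: bij_betw_def endo_inj_surj)
  then have \<sigma>: "\<sigma> \<in> Sym m" unfolding Sym_def by (auto intro: bij_imp_permutes simp: \<sigma>_def)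
  have "\<tau> x = insert_min m k \<sigma> x" for x
  proof (cases "x \<in> {1..m + 1}")
    case True
    then show ?thesis
      by (rule skip_cases[OF _ k]) (use ge2 \<tau>k in \<open>force simp: insert_min_skip[OF k] \<sigma>_def\<close>)+
  next
    case False
    then have "\<tau> x = x" using SymD[OF \<tau>] by (simp add: permutes_def)
    then show ?thesis using False k by (auto simp: insert_min_def)
  qed
  then show ?thesis using that[OF k \<sigma>] by blast
qed

lemma insert_min_inject:
  assumes "\<sigma> \<in> Sym m" "\<sigma>' \<in> Sym m" "k \<in> {1..m + 1}" "k' \<in> {1..m + 1}"
    and eq: "insert_min m k \<sigma> = insert_min m k' \<sigma>'"
  shows "k = k'" "\<sigma> = \<sigma>'"
proof -
  have "insert_min m k \<sigma> k' = insert_min m k \<sigma> k" unfolding insert_min_at by (simp add: eq)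
  then show k: "k = k'" using Sym_inj[OF insert_min_Sym[OF assms(1,3)], of k' k] by blast
  show "\<sigma> = \<sigma>'"
  proof
    fix i
    show "\<sigma> i = \<sigma>' i"
    proof (cases "i \<in> {1..m}")
      case True
      then show ?thesis using insert_min_skip[of k m i \<sigma>] insert_min_skip[of k m i \<sigma>'] assms k by simp
    next
      case False
      then show ?thesis using SymD[OF assms(1)] SymD[OF assms(2)] by (simp add: permutes_def)
    qed
  qed
qed

text \<open>
  The condition on the first descent says that the word increases up to its top letter: the top
  letter is followed by a fall, or ends the word.
\<close>

lemma MM_iff:
  assumes m: "m \<ge> 1"
  shows "\<sigma> \<in> MM m \<longleftrightarrow> \<sigma> \<in> Sym m \<and> (\<forall>i. 1 \<le> i \<and> i < inv \<sigma> m \<longrightarrow> rises m \<sigma> i)"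
proof (cases "\<sigma> \<in> Sym m")
  case True
  define T where "T = inv \<sigma> m"
  have \<sigma>T: "\<sigma> i = m \<longleftrightarrow> i = T" for i
    unfolding T_def using permutes_inverses[OF SymD[OF True]] by metis
  have T: "T \<in> {1..m}" using permutes_in_image[OF SymD[OF True], of T] \<sigma>T[of T] m by simp
  have fall: "\<sigma> (i + 1) < \<sigma> i \<longleftrightarrow> \<not> rises m \<sigma> i" if "i \<in> {1..<m}" for i
    using that Sym_inj[OF True, of i "i + 1"] by (auto simp: rises_iff)
  have "\<sigma> \<in> MM m \<longleftrightarrow> (\<forall>i\<in>{1..<m}. \<not> rises m \<sigma> i \<and> (\<forall>k\<in>{1..<i}. rises m \<sigma> k) \<longrightarrow> i = T)"
    using True fall by (auto simp: MM_def \<sigma>T)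
  also have "\<dots> \<longleftrightarrow> (\<forall>i. 1 \<le> i \<and> i < T \<longrightarrow> rises m \<sigma> i)"
  proof (intro iffI allI impI)
    fix i assume first: "\<forall>i\<in>{1..<m}. \<not> rises m \<sigma> i \<and> (\<forall>k\<in>{1..<i}. rises m \<sigma> k) \<longrightarrow> i = T"
      and "1 \<le> i \<and> i < T"
    then show "rises m \<sigma> i"
    proof (induction i rule: less_induct)
      case (less i)
      then show ?case using T by force
    qed
  next
    assume rise: "\<forall>i. 1 \<le> i \<and> i < T \<longrightarrow> rises m \<sigma> i"
    \<comment> \<open>The letter after the top one is smaller, or it is the final zero.\<close>
    have fallT: "\<not> rises m \<sigma> T"
      using T Sym_in_range[OF True, of "T + 1"] \<sigma>T[of T] by (auto simp: rises_def letter_def)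
    show "\<forall>i\<in>{1..<m}. \<not> rises m \<sigma> i \<and> (\<forall>k\<in>{1..<i}. rises m \<sigma> k) \<longrightarrow> i = T"
    proof (intro ballI impI)
      fix i assume i: "i \<in> {1..<m}" "\<not> rises m \<sigma> i \<and> (\<forall>k\<in>{1..<i}. rises m \<sigma> k)"
      then have "\<not> i < T" using rise by auto
      moreover have "\<not> T < i" using i fallT T by auto
      ultimately show "i = T" by simp
    qed
  qed
  finally show ?thesis using True by (simp add: T_def)
qed (simp add: MM_def)

text \<open>
  As the word increases up to the top letter, which exceeds everything after it, the left-to-right
  maxima are exactly the positions up to that of the top letter.
\<close>

lemma MM_facts:
  assumes \<sigma>: "\<sigma> \<in> MM m" and m: "m \<ge> 1"
  defines "T \<equiv> inv \<sigma> m"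
  shows MM_Sym: "\<sigma> \<in> Sym m"
    and top_in: "T \<in> {1..m}"
    and top_eq: "\<sigma> i = m \<longleftrightarrow> i = T"
    and rises_before_top: "1 \<le> i \<Longrightarrow> i < T \<Longrightarrow> rises m \<sigma> i"
    and not_rises_top: "\<not> rises m \<sigma> T"
    and lr_maxima_MM: "lr_maxima m \<sigma> = {1..T}"
proof -
  show S: "\<sigma> \<in> Sym m" using \<sigma> by (simp add: MM_def)
  show eq: "\<sigma> i = m \<longleftrightarrow> i = T" for i
    unfolding T_def using permutes_inverses[OF SymD[OF S]] by metis
  show T: "T \<in> {1..m}" using permutes_in_image[OF SymD[OF S], of T] eq[of T] m by simp
  show rise: "rises m \<sigma> i" if "1 \<le> i" "i < T" for i
    using \<sigma> that unfolding MM_iff[OF m] T_def by blast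
  show "\<not> rises m \<sigma> T"
    using T Sym_in_range[OF S, of "T + 1"] eq[of T] by (auto simp: rises_def letter_def)
  have incr: "\<sigma> k < \<sigma> i" if "1 \<le> k" "k < i" "i \<le> T" for k i
    using that(2,3)
  proof (induction i)
    case (Suc i)
    have "\<sigma> i < \<sigma> (Suc i)" using rise[of i] that(1) Suc.prems T by (simp add: rises_iff)
    then show ?case using Suc by (cases "k = i") auto
  qed simp
  have "i \<le> T" if "i \<in> {1..m}" "\<forall>k\<in>{1..<i}. \<sigma> k < \<sigma> i" for i
  proof (rule ccontr)
    assume "\<not> i \<le> T"
    then have "m < \<sigma> i" using that T eq[of T] by auto
    then show False using Sym_in_range[OF S that(1)] by simp
  qed
  then have "lr_maxima m \<sigma> \<subseteq> {1..T}" by (auto simp: lr_maxima_def)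
  moreover have "{1..T} \<subseteq> lr_maxima m \<sigma>" using incr T by (force simp: lr_maxima_def)
  ultimately show "lr_maxima m \<sigma> = {1..T}" by blast
qed

text \<open>
  A new smallest letter splits the step across its gap into a fall and a rise; at the two ends of
  the word the surrounding zeros make it two rises or two falls instead.
\<close>

lemma
  assumes \<sigma>: "\<sigma> \<in> Sym m" and m: "m \<ge> 1" and k: "k \<in> {1..m + 1}"
  defines "\<tau> \<equiv> insert_min m k \<sigma>"
  shows rises_insert_min_pred: "rises (m + 1) \<tau> (k - 1) \<longleftrightarrow> k = 1"
    and rises_insert_min_at: "rises (m + 1) \<tau> k \<longleftrightarrow> k \<le> m"
    and rises_insert_min_skip_pred:
      "i \<in> {1..m} \<Longrightarrow> rises (m + 1) \<tau> (skip k i - 1) \<longleftrightarrow> i = k \<or> rises m \<sigma> (i - 1)"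
    and rises_insert_min_skip:
      "i \<in> {1..m} \<Longrightarrow> rises (m + 1) \<tau> (skip k i) \<longleftrightarrow> i + 1 \<noteq> k \<and> rises m \<sigma> i"
proof -
  have let_k: "letter (m + 1) \<tau> k = 1" using k by (simp add: letter_def \<tau>_def)
  have let_skip: "letter (m + 1) \<tau> (skip k i) = letter m \<sigma> i + 1" if "i \<in> {1..m}" for i
    using skip_in[of k i m] insert_min_skip[OF k that, of \<sigma>] that k by (auto simp: letter_def \<tau>_def)
  have let_0: "letter (m + 1) \<tau> 0 = 0" "letter (m + 1) \<tau> (m + 2) = 0"
    "letter m \<sigma> 0 = 0" "letter m \<sigma> (m + 1) = 0"
    by (simp_all add: letter_def)
  have pos: "letter m \<sigma> i > 0" if "i \<in> {1..m}" for i
    using Sym_in_range[OF \<sigma> that] that by (auto simp: letter_def)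
  show "rises (m + 1) \<tau> (k - 1) \<longleftrightarrow> k = 1"
  proof (cases "k = 1")
    case False
    then have "k - 1 = skip k (k - 1)" "k - 1 \<in> {1..m}" using k by (auto simp: skip_def)
    then show ?thesis using let_skip[of "k - 1"] let_k k False by (simp add: rises_def)
  qed (use let_k let_0 in \<open>simp add: rises_def\<close>)
  show "rises (m + 1) \<tau> k \<longleftrightarrow> k \<le> m"
  proof (cases "k \<le> m")
    case True
    then have "k + 1 = skip k k" "k \<in> {1..m}" using k by (auto simp: skip_def)
    then show ?thesis using let_skip[of k] let_k True pos[of k] by (simp add: rises_def)
  next
    case False
    then have "k = m + 1" using k by simp
    then show ?thesis using let_k by (simp add: rises_def letter_def)
  qed
  assume i: "i \<in> {1..m}"
  show "rises (m + 1) \<tau> (skip k i) \<longleftrightarrow> i + 1 \<noteq> k \<and> rises m \<sigma> i"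
  proof (cases "i + 1 = k")
    case True
    then have "skip k i + 1 = k" by (simp add: skip_def)
    then show ?thesis using True let_skip[OF i] let_k by (simp add: rises_def)
  next
    case False
    show ?thesis
    proof (cases "i = m")
      case True
      then have "skip k i = m + 1" using False k by (auto simp: skip_def)
      then show ?thesis using True by (simp add: not_rises_last[of "m + 1", simplified] not_rises_last)
    next
      assume "i \<noteq> m"
      moreover have "skip k i + 1 = skip k (i + 1)" using False by (auto simp: skip_def)
      ultimately show ?thesis
        using False let_skip[OF i] let_skip[of "i + 1"] i by (simp add: rises_def)
    qed
  qed
  show "rises (m + 1) \<tau> (skip k i - 1) \<longleftrightarrow> i = k \<or> rises m \<sigma> (i - 1)"
  proof (cases "i = k")
    case True
    then have "skip k i - 1 = k" "skip k i = k + 1" by (simp_all add: skip_def)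
    then show ?thesis using True let_skip[OF i] let_k pos[OF i] by (simp add: rises_def)
  next
    case False
    show ?thesis
    proof (cases "i = 1")
      case True
      then have "skip k i = 1" using False k by (auto simp: skip_def)
      then show ?thesis using True let_skip[OF i] let_0 pos[OF i] by (simp add: rises_def)
    next
      assume "i \<noteq> 1"
      moreover have "skip k i = skip k (i - 1) + 1" using False i \<open>i \<noteq> 1\<close> by (auto simp: skip_def)
      moreover have "i - 1 \<in> {1..m}" using i \<open>i \<noteq> 1\<close> by auto
      ultimately show ?thesis
        using False let_skip[OF i] let_skip[of "i - 1"] by (cases i) (simp_all add: rises_def)
    qed
  qed
qed

text \<open>
  All left-to-right maxima but the top letter are double ascents.
\<close>

lemma lmax_MM:
  assumes MM: "\<sigma> \<in> MM m" and m: "m \<ge> 1"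
  shows "lmax m \<sigma> = lmaxda m \<sigma> + 1"
proof -
  note \<sigma> = MM_Sym[OF MM m]
  define T where "T = inv \<sigma> m"
  note top = MM_facts(2-6)[OF MM m, folded T_def]
  have up: "rises m \<sigma> i" if "i < T" for i
    using that top(3)[of i] rises_0[OF \<sigma> m] by (cases "i = 0") auto
  have "lr_maxima m \<sigma> \<inter> double_ascents m \<sigma> = {1..<T}"
    unfolding top(5) double_ascents_rises[OF \<sigma>] using up top(1,4) by (auto simp: le_less)
  then show ?thesis using top(1) unfolding lmaxda_def lmax_def top(5) by simp
qed

text \<open>
  A new smallest letter strictly inside the initial increasing run would create a fall before the
  top letter; everywhere else it is allowed.
\<close>

lemma insert_min_MM_iff:
  assumes \<sigma>: "\<sigma> \<in> Sym m" and m: "m \<ge> 1" and k: "k \<in> {1..m + 1}"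
  shows "insert_min m k \<sigma> \<in> MM (m + 1) \<longleftrightarrow> \<sigma> \<in> MM m \<and> (k = 1 \<or> inv \<sigma> m < k)"
proof -
  define \<tau> where "\<tau> = insert_min m k \<sigma>"
  define T where "T = inv \<sigma> m"
  have \<sigma>T: "\<sigma> T = m" unfolding T_def by (rule permutes_inverses[OF SymD[OF \<sigma>]])
  have T: "T \<in> {1..m}" using permutes_in_image[OF SymD[OF \<sigma>], of T] \<sigma>T m by simp
  have \<tau>: "\<tau> \<in> Sym (m + 1)" unfolding \<tau>_def by (rule insert_min_Sym[OF \<sigma> k])
  have "\<tau> (skip k T) = m + 1" using insert_min_skip[OF k T, of \<sigma>] \<sigma>T by (simp add: \<tau>_def)
  then have inv\<tau>: "inv \<tau> (m + 1) = skip k T"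
    using permutes_inverses(2)[OF SymD[OF \<tau>], of "skip k T"] by simp
  note r = rises_insert_min_pred[OF \<sigma> m k] rises_insert_min_at[OF \<sigma> m k]
    rises_insert_min_skip[OF \<sigma> m k]
  have MM\<tau>: "\<tau> \<in> MM (m + 1) \<longleftrightarrow> (\<forall>j. 1 \<le> j \<and> j < skip k T \<longrightarrow> rises (m + 1) \<tau> j)"
    using MM_iff[of "m + 1" \<tau>] \<tau> inv\<tau> by simp
  have MM\<sigma>: "\<sigma> \<in> MM m \<longleftrightarrow> (\<forall>i. 1 \<le> i \<and> i < T \<longrightarrow> rises m \<sigma> i)"
    using MM_iff[OF m, of \<sigma>] \<sigma> by (simp add: T_def)
  have "\<tau> \<in> MM (m + 1) \<longleftrightarrow> \<sigma> \<in> MM m \<and> (k = 1 \<or> T < k)"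
  proof
    assume rise: "\<tau> \<in> MM (m + 1)"
    have "k = 1 \<or> T < k"
    proof (rule ccontr)
      assume "\<not> (k = 1 \<or> T < k)"
      then have "1 \<le> k - 1" "k - 1 < skip k T" using k by (auto simp: skip_def)
      then have "rises (m + 1) \<tau> (k - 1)" using rise unfolding MM\<tau> by blast
      then show False using r(1) \<open>\<not> (k = 1 \<or> T < k)\<close> by (simp add: \<tau>_def)
    qed
    moreover have "rises m \<sigma> i" if "1 \<le> i" "i < T" for i
    proof -
      have "1 \<le> skip k i" "skip k i < skip k T" using that by (auto simp: skip_def)
      then have "rises (m + 1) \<tau> (skip k i)" using rise unfolding MM\<tau> by blast
      then show ?thesis using r(3)[of i] that T by (simp add: \<tau>_def)
    qed
    ultimately show "\<sigma> \<in> MM m \<and> (k = 1 \<or> T < k)" unfolding MM\<sigma> by blast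
  next
    assume asm: "\<sigma> \<in> MM m \<and> (k = 1 \<or> T < k)"
    show "\<tau> \<in> MM (m + 1)"
      unfolding MM\<tau>
    proof (intro allI impI)
      fix j assume j: "1 \<le> j \<and> j < skip k T"
      then have "j \<in> {1..m + 1}" using skip_in[of k T m] T k by auto
      then show "rises (m + 1) \<tau> j"
      proof (rule skip_cases[OF _ k])
        assume "j = k"
        then have "k \<le> m" using j asm T by (auto simp: skip_def split: if_splits)
        then show ?thesis using r(2) \<open>j = k\<close> by (simp add: \<tau>_def)
      next
        fix i assume i: "i \<in> {1..m}" "j = skip k i"
        then have "i < T" using j by simp
        then have "rises m \<sigma> i" "i + 1 \<noteq> k" using asm i unfolding MM\<sigma> by auto
        then show ?thesis using r(3)[OF i(1)] i(2) by (simp add: \<tau>_def)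
      qed
    qed
  qed
  then show ?thesis by (simp add: \<tau>_def T_def)
qed

definition min_slots :: "nat \<Rightarrow> (nat \<Rightarrow> nat) \<Rightarrow> nat set" where
  "min_slots m \<sigma> = insert 1 {inv \<sigma> m<..m + 1}"

lemma finite_MM [simp]: "finite (MM m)"
  by (rule finite_subset[OF _ finite_Sym[of m]]) (auto simp: MM_def)

lemma sum_MM_Suc:
  assumes m: "m \<ge> 1"
  shows "(\<Sum>\<tau>\<in>MM (m + 1). G \<tau>) = (\<Sum>\<sigma>\<in>MM m. \<Sum>k\<in>min_slots m \<sigma>. G (insert_min m k \<sigma>))"
proof -
  let ?f = "\<lambda>(\<sigma>, k). insert_min m k \<sigma>"
  have slots: "min_slots m \<sigma> \<subseteq> {1..m + 1}" if "\<sigma> \<in> MM m" for \<sigma>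
    by (auto simp: min_slots_def)
  have "inj_on ?f (SIGMA \<sigma>:MM m. min_slots m \<sigma>)"
  proof (rule inj_onI, clarify)
    fix \<sigma> k \<sigma>' k'
    assume "\<sigma> \<in> MM m" "k \<in> min_slots m \<sigma>" "\<sigma>' \<in> MM m" "k' \<in> min_slots m \<sigma>'"
      "insert_min m k \<sigma> = insert_min m k' \<sigma>'"
    then show "\<sigma> = \<sigma>' \<and> k = k'"
      using insert_min_inject[of \<sigma> m \<sigma>' k k'] slots MM_Sym[OF _ m] by blast
  qed
  moreover have "?f ` (SIGMA \<sigma>:MM m. min_slots m \<sigma>) = MM (m + 1)"
  proof (intro equalityI subsetI)
    fix \<tau> assume "\<tau> \<in> ?f ` (SIGMA \<sigma>:MM m. min_slots m \<sigma>)"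
    then obtain \<sigma> k where \<sigma>: "\<sigma> \<in> MM m" "k \<in> min_slots m \<sigma>" "\<tau> = insert_min m k \<sigma>" by auto
    moreover have "k \<in> {1..m + 1}" using slots \<sigma> by blast
    moreover have "k = 1 \<or> inv \<sigma> m < k" using \<sigma>(2) by (auto simp: min_slots_def)
    ultimately show "\<tau> \<in> MM (m + 1)"
      using insert_min_MM_iff[OF MM_Sym[OF \<sigma>(1) m] m] by blast
  next
    fix \<tau> assume \<tau>: "\<tau> \<in> MM (m + 1)"
    then have "\<tau> \<in> Sym (m + 1)" by (simp add: MM_def)
    then obtain k \<sigma> where k: "k \<in> {1..m + 1}" and \<sigma>: "\<sigma> \<in> Sym m" and eq: "\<tau> = insert_min m k \<sigma>"
      by (rule Sym_insert_min_exists)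
    then have "\<sigma> \<in> MM m" "k = 1 \<or> inv \<sigma> m < k"
      using insert_min_MM_iff[OF \<sigma> m k] \<tau> by auto
    then have "(\<sigma>, k) \<in> (SIGMA \<sigma>:MM m. min_slots m \<sigma>)"
      using k by (auto simp: min_slots_def)
    then show "\<tau> \<in> ?f ` (SIGMA \<sigma>:MM m. min_slots m \<sigma>)"
      using eq by (force simp: image_iff)
  qed
  ultimately have bij: "bij_betw ?f (SIGMA \<sigma>:MM m. min_slots m \<sigma>) (MM (m + 1))"
    by (simp add: bij_betw_def)
  have "(\<Sum>\<tau>\<in>MM (m + 1). G \<tau>) = (\<Sum>x\<in>(SIGMA \<sigma>:MM m. min_slots m \<sigma>). G (?f x))"
    by (rule sum.reindex_bij_betw[OF bij, symmetric])
  also have "\<dots> = (\<Sum>\<sigma>\<in>MM m. \<Sum>k\<in>min_slots m \<sigma>. G (insert_min m k \<sigma>))"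
    by (subst sum.Sigma) (auto simp: min_slots_def intro!: sum.cong)
  finally show ?thesis .
qed

text \<open>
  Sets of positions of the longer word are computed from the inserted position and the shifted old
  ones.
\<close>

lemma skip_image_decomp:
  assumes k: "k \<in> {1..m + 1}" and X: "X \<subseteq> {1..m + 1}"
  shows "X = (if k \<in> X then {k} else {}) \<union> skip k ` {i \<in> {1..m}. skip k i \<in> X}"
proof (rule set_eqI)
  fix x
  show "x \<in> X \<longleftrightarrow> x \<in> (if k \<in> X then {k} else {}) \<union> skip k ` {i \<in> {1..m}. skip k i \<in> X}"
  proof (cases "x \<in> {1..m + 1}")
    case True
    then show ?thesis
      by (rule skip_cases[OF _ k]) (auto simp: image_iff inj_eq[OF inj_skip])
  next
    case False
    then show ?thesis using X skip_in[of k _ m] k by (auto split: if_splits)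
  qed
qed

text \<open>
  The new letter is a double ascent at the front, a double descent at the end, and a valley
  elsewhere. It hides no maximum, and it is a maximum itself only at the front or at the end. Among
  the old letters, the left neighbour of the new one now falls and the right neighbour is now
  reached by a rise.
\<close>

lemma
  assumes \<sigma>: "\<sigma> \<in> Sym m" and m: "m \<ge> 1" and k: "k \<in> {1..m + 1}"
  defines "\<tau> \<equiv> insert_min m k \<sigma>"
  shows peaks_insert_min: "peaks (m + 1) \<tau>
      = skip k ` {i \<in> {1..m}. (i = k \<or> rises m \<sigma> (i - 1)) \<and> \<not> (i + 1 \<noteq> k \<and> rises m \<sigma> i)}"
    and double_ascents_insert_min: "double_ascents (m + 1) \<tau> = (if k = 1 then {1} else {})
      \<union> skip k ` {i \<in> {1..m}. (i = k \<or> rises m \<sigma> (i - 1)) \<and> i + 1 \<noteq> k \<and> rises m \<sigma> i}"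
    and double_descents_insert_min: "double_descents (m + 1) \<tau> = (if k = m + 1 then {m + 1} else {})
      \<union> skip k ` {i \<in> {1..m}. \<not> (i = k \<or> rises m \<sigma> (i - 1)) \<and> \<not> (i + 1 \<noteq> k \<and> rises m \<sigma> i)}"
    and lr_maxima_insert_min: "lr_maxima (m + 1) \<tau>
      = (if k = 1 then {1} else {}) \<union> skip k ` lr_maxima m \<sigma>"
    and rl_maxima_insert_min: "rl_maxima (m + 1) \<tau>
      = (if k = m + 1 then {m + 1} else {}) \<union> skip k ` rl_maxima m \<sigma>"
proof -
  have \<tau>: "\<tau> \<in> Sym (m + 1)" unfolding \<tau>_def by (rule insert_min_Sym[OF \<sigma> k])
  note r = rises_insert_min_pred[OF \<sigma> m k, folded \<tau>_def] rises_insert_min_at[OF \<sigma> m k, folded \<tau>_def]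
    rises_insert_min_skip_pred[OF \<sigma> m k, folded \<tau>_def] rises_insert_min_skip[OF \<sigma> m k, folded \<tau>_def]
  have si: "skip k i \<in> {1..m + 1}" if "i \<in> {1..m}" for i using skip_in[of k i m] that k by simp
  have k1: "k = 1 \<Longrightarrow> k \<le> m" using m by simp
  have split: "X = (if k \<in> X then {k} else {}) \<union> skip k ` {i \<in> {1..m}. skip k i \<in> X}"
    if "X \<subseteq> {1..m + 1}" for X by (rule skip_image_decomp[OF k that])
  have "{i \<in> {1..m}. skip k i \<in> peaks (m + 1) \<tau>}
      = {i \<in> {1..m}. (i = k \<or> rises m \<sigma> (i - 1)) \<and> \<not> (i + 1 \<noteq> k \<and> rises m \<sigma> i)}"
    using si r(3,4) unfolding peaks_rises[OF \<tau>] by blast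
  moreover have "k \<notin> peaks (m + 1) \<tau>"
    using r(1,2) k1 unfolding peaks_rises[OF \<tau>] by blast
  moreover have "peaks (m + 1) \<tau> \<subseteq> {1..m + 1}" unfolding peaks_def by blast
  ultimately show "peaks (m + 1) \<tau>
      = skip k ` {i \<in> {1..m}. (i = k \<or> rises m \<sigma> (i - 1)) \<and> \<not> (i + 1 \<noteq> k \<and> rises m \<sigma> i)}"
    using split[of "peaks (m + 1) \<tau>"] by simp
  have "{i \<in> {1..m}. skip k i \<in> double_ascents (m + 1) \<tau>}
      = {i \<in> {1..m}. (i = k \<or> rises m \<sigma> (i - 1)) \<and> i + 1 \<noteq> k \<and> rises m \<sigma> i}"
    using si r(3,4) unfolding double_ascents_rises[OF \<tau>] by blast
  moreover have "k \<in> double_ascents (m + 1) \<tau> \<longleftrightarrow> k = 1"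
    using r(1,2) k k1 unfolding double_ascents_rises[OF \<tau>] by blast
  moreover have "double_ascents (m + 1) \<tau> \<subseteq> {1..m + 1}" unfolding double_ascents_def by blast
  ultimately show "double_ascents (m + 1) \<tau> = (if k = 1 then {1} else {})
      \<union> skip k ` {i \<in> {1..m}. (i = k \<or> rises m \<sigma> (i - 1)) \<and> i + 1 \<noteq> k \<and> rises m \<sigma> i}"
    using split[of "double_ascents (m + 1) \<tau>"] by simp
  have "{i \<in> {1..m}. skip k i \<in> double_descents (m + 1) \<tau>}
      = {i \<in> {1..m}. \<not> (i = k \<or> rises m \<sigma> (i - 1)) \<and> \<not> (i + 1 \<noteq> k \<and> rises m \<sigma> i)}"
    using si r(3,4) unfolding double_descents_rises[OF \<tau>] by blast
  moreover have "k \<in> double_descents (m + 1) \<tau> \<longleftrightarrow> k = m + 1"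
  proof -
    have "k \<in> double_descents (m + 1) \<tau> \<longleftrightarrow> k \<noteq> 1 \<and> \<not> k \<le> m"
      using r(1,2) k unfolding double_descents_rises[OF \<tau>] by blast
    then show ?thesis using k m by auto
  qed
  moreover have "double_descents (m + 1) \<tau> \<subseteq> {1..m + 1}" unfolding double_descents_def by blast
  ultimately show "double_descents (m + 1) \<tau> = (if k = m + 1 then {m + 1} else {})
      \<union> skip k ` {i \<in> {1..m}. \<not> (i = k \<or> rises m \<sigma> (i - 1)) \<and> \<not> (i + 1 \<noteq> k \<and> rises m \<sigma> i)}"
    using split[of "double_descents (m + 1) \<tau>"] by simp
  have val: "\<tau> k = 1" "\<And>i. i \<in> {1..m} \<Longrightarrow> \<tau> (skip k i) = \<sigma> i + 1"
    using insert_min_skip[OF k] by (simp_all add: \<tau>_def)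
  have pos: "1 \<le> \<sigma> i" if "i \<in> {1..m}" for i using Sym_in_range[OF \<sigma> that] by simp
  have lrmem: "x \<in> lr_maxima (m + 1) \<tau> \<longleftrightarrow>
      (\<forall>y\<in>{1..m + 1}. y < x \<longrightarrow> \<tau> y < \<tau> x)" if "x \<in> {1..m + 1}" for x
    using that by (auto simp: lr_maxima_def)
  have rlmem: "x \<in> rl_maxima (m + 1) \<tau> \<longleftrightarrow>
      (\<forall>y\<in>{1..m + 1}. x < y \<longrightarrow> \<tau> y < \<tau> x)" if "x \<in> {1..m + 1}" for x
    using that by (auto simp: rl_maxima_def)
  have all: "(\<forall>y\<in>{1..m + 1}. Q y) \<longleftrightarrow> Q k \<and> (\<forall>i\<in>{1..m}. Q (skip k i))" for Q
    using skip_cases[OF _ k] si k by metis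
  have "skip k i \<in> lr_maxima (m + 1) \<tau> \<longleftrightarrow> i \<in> lr_maxima m \<sigma>" if "i \<in> {1..m}" for i
    unfolding lrmem[OF si[OF that]] all using that pos[OF that] val
    by (auto simp: lr_maxima_def)
  then have "{i \<in> {1..m}. skip k i \<in> lr_maxima (m + 1) \<tau>} = lr_maxima m \<sigma>"
    by (auto simp: lr_maxima_def)
  moreover have "k \<in> lr_maxima (m + 1) \<tau> \<longleftrightarrow> k = 1"
  proof
    assume L: "k \<in> lr_maxima (m + 1) \<tau>"
    show "k = 1"
    proof (rule ccontr)
      assume "k \<noteq> 1"
      then have "skip k 1 = 1" "1 < k" using k by (auto simp: skip_def)
      then have "\<tau> 1 < \<tau> k" using L k unfolding lrmem[OF k] by auto
      then show False using val(2)[of 1] val(1) m \<open>skip k 1 = 1\<close> by simp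
    qed
  qed (use m in \<open>auto simp: lr_maxima_def\<close>)
  moreover have "lr_maxima (m + 1) \<tau> \<subseteq> {1..m + 1}" unfolding lr_maxima_def by blast
  ultimately show "lr_maxima (m + 1) \<tau> = (if k = 1 then {1} else {}) \<union> skip k ` lr_maxima m \<sigma>"
    using split[of "lr_maxima (m + 1) \<tau>"] by simp
  have "skip k i \<in> rl_maxima (m + 1) \<tau> \<longleftrightarrow> i \<in> rl_maxima m \<sigma>" if "i \<in> {1..m}" for i
    unfolding rlmem[OF si[OF that]] all using that pos[OF that] val
    by (auto simp: rl_maxima_def)
  then have "{i \<in> {1..m}. skip k i \<in> rl_maxima (m + 1) \<tau>} = rl_maxima m \<sigma>"
    by (auto simp: rl_maxima_def)
  moreover have "k \<in> rl_maxima (m + 1) \<tau> \<longleftrightarrow> k = m + 1"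
  proof
    assume L: "k \<in> rl_maxima (m + 1) \<tau>"
    show "k = m + 1"
    proof (rule ccontr)
      assume "k \<noteq> m + 1"
      then have "skip k m = m + 1" "k < m + 1" using k by (auto simp: skip_def)
      then have "\<tau> (m + 1) < \<tau> k" using L k unfolding rlmem[OF k] by auto
      then show False using val(2)[of m] val(1) m \<open>skip k m = m + 1\<close> by simp
    qed
  qed (use m in \<open>auto simp: rl_maxima_def\<close>)
  moreover have "rl_maxima (m + 1) \<tau> \<subseteq> {1..m + 1}" unfolding rl_maxima_def by blast
  ultimately show "rl_maxima (m + 1) \<tau> = (if k = m + 1 then {m + 1} else {}) \<union> skip k ` rl_maxima m \<sigma>"
    using split[of "rl_maxima (m + 1) \<tau>"] by simp
qed

text \<open>
  The vector of statistics matching \<open>word_insertion\<close>. A word has one peak more than its cyclic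
  counterpart because of the top letter, which likewise contributes one left-to-right and one
  right-to-left maximum. The double ascents among the left-to-right maxima and the double descents
  among the right-to-left maxima take the place of fixed points.
\<close>

definition word_weight ::
    "(nat \<Rightarrow> nat \<Rightarrow> nat \<Rightarrow> nat \<Rightarrow> nat \<Rightarrow> nat \<Rightarrow> 'a) \<Rightarrow> nat \<Rightarrow> (nat \<Rightarrow> nat) \<Rightarrow> 'a" where
  "word_weight g m \<sigma> = g (pk m \<sigma> - 1)
     (card (double_ascents m \<sigma> - lr_maxima m \<sigma>)) (card (double_descents m \<sigma> - rl_maxima m \<sigma>))
     (rmaxdd m \<sigma>) (lmaxda m \<sigma>) (lmax m \<sigma> + rmax m \<sigma> - 2)"

lemma maxima_positive:
  assumes "m \<ge> 1"
  shows "lmax m \<sigma> \<ge> 1" "rmax m \<sigma> \<ge> 1"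
proof -
  have "1 \<in> lr_maxima m \<sigma>" "m \<in> rl_maxima m \<sigma>"
    using assms by (auto simp: lr_maxima_def rl_maxima_def)
  then show "lmax m \<sigma> \<ge> 1" "rmax m \<sigma> \<ge> 1"
    unfolding lmax_def rmax_def by (auto simp: Suc_le_eq card_gt_0_iff)
qed

lemma card_skip_image: "card (skip k ` X) = card X"
  by (rule card_image) (rule inj_on_subset[OF inj_skip subset_UNIV])

lemma card_insert_skip_image:
  "finite X \<Longrightarrow> card ((if b then {k} else {}) \<union> skip k ` X) = card X + (if b then 1 else 0)"
proof -
  assume "finite X"
  moreover have "k \<notin> skip k ` X" using skip_neq[of k] by (metis imageE)
  ultimately show ?thesis by (simp add: card_skip_image)
qed

text \<open>
  The inserted letter is a double ascent precisely when it is a left-to-right maximum, and a double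
  descent precisely when it is a right-to-left maximum. So both sets gain it under the same
  condition \<open>b\<close>.
\<close>

lemma insert_skip_image_algebra:
  "((if b then {k} else {}) \<union> skip k ` X) \<inter> ((if b then {k} else {}) \<union> skip k ` Y)
     = (if b then {k} else {}) \<union> skip k ` (X \<inter> Y)"
  "((if b then {k} else {}) \<union> skip k ` X) - ((if b then {k} else {}) \<union> skip k ` Y) = skip k ` (X - Y)"
proof -
  have "k \<notin> skip k ` X" for X using skip_neq[of k] by (metis imageE)
  then show "((if b then {k} else {}) \<union> skip k ` X) \<inter> ((if b then {k} else {}) \<union> skip k ` Y)
     = (if b then {k} else {}) \<union> skip k ` (X \<inter> Y)"
    "((if b then {k} else {}) \<union> skip k ` X) - ((if b then {k} else {}) \<union> skip k ` Y) = skip k ` (X - Y)"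
    by (auto simp: image_Int[OF inj_skip] image_set_diff[OF inj_skip])
qed

lemma word_weight_insert_min:
  fixes g :: "nat \<Rightarrow> nat \<Rightarrow> nat \<Rightarrow> nat \<Rightarrow> nat \<Rightarrow> nat \<Rightarrow> 'a"
  assumes \<sigma>: "\<sigma> \<in> Sym m" and m: "m \<ge> 1" and k: "k \<in> {1..m + 1}"
  defines "P \<equiv> {i \<in> {1..m}. (i = k \<or> rises m \<sigma> (i - 1)) \<and> \<not> (i + 1 \<noteq> k \<and> rises m \<sigma> i)}"
    and "A \<equiv> {i \<in> {1..m}. (i = k \<or> rises m \<sigma> (i - 1)) \<and> i + 1 \<noteq> k \<and> rises m \<sigma> i}"
    and "D \<equiv> {i \<in> {1..m}. \<not> (i = k \<or> rises m \<sigma> (i - 1)) \<and> \<not> (i + 1 \<noteq> k \<and> rises m \<sigma> i)}"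
  shows "word_weight g (m + 1) (insert_min m k \<sigma>) =
    g (card P - 1) (card (A - lr_maxima m \<sigma>)) (card (D - rl_maxima m \<sigma>))
      (card (rl_maxima m \<sigma> \<inter> D) + (if k = m + 1 then 1 else 0))
      (card (lr_maxima m \<sigma> \<inter> A) + (if k = 1 then 1 else 0))
      (lmax m \<sigma> + rmax m \<sigma> - 2 + (if k = 1 then 1 else 0) + (if k = m + 1 then 1 else 0))"
proof -
  let ?\<tau> = "insert_min m k \<sigma>"
  have fin: "finite P" "finite A" "finite D" by (simp_all add: P_def A_def D_def)
  have p: "peaks (m + 1) ?\<tau> = skip k ` P" unfolding P_def by (rule peaks_insert_min[OF \<sigma> m k])
  have a: "double_ascents (m + 1) ?\<tau> = (if k = 1 then {k} else {}) \<union> skip k ` A"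
    unfolding A_def double_ascents_insert_min[OF \<sigma> m k] by simp
  have d: "double_descents (m + 1) ?\<tau> = (if k = m + 1 then {k} else {}) \<union> skip k ` D"
    unfolding D_def double_descents_insert_min[OF \<sigma> m k] by simp
  have l: "lr_maxima (m + 1) ?\<tau> = (if k = 1 then {k} else {}) \<union> skip k ` lr_maxima m \<sigma>"
    unfolding lr_maxima_insert_min[OF \<sigma> m k] by simp
  have r: "rl_maxima (m + 1) ?\<tau> = (if k = m + 1 then {k} else {}) \<union> skip k ` rl_maxima m \<sigma>"
    unfolding rl_maxima_insert_min[OF \<sigma> m k] by simp
  have "pk (m + 1) ?\<tau> = card P" by (simp only: pk_def p card_skip_image)
  moreover have "card (double_ascents (m + 1) ?\<tau> - lr_maxima (m + 1) ?\<tau>) = card (A - lr_maxima m \<sigma>)"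
    unfolding a l insert_skip_image_algebra by (rule card_skip_image)
  moreover have "card (double_descents (m + 1) ?\<tau> - rl_maxima (m + 1) ?\<tau>) = card (D - rl_maxima m \<sigma>)"
    unfolding d r insert_skip_image_algebra by (rule card_skip_image)
  moreover have "rmaxdd (m + 1) ?\<tau> = card (rl_maxima m \<sigma> \<inter> D) + (if k = m + 1 then 1 else 0)"
    unfolding rmaxdd_def d r insert_skip_image_algebra by (rule card_insert_skip_image) (simp add: fin)
  moreover have "lmaxda (m + 1) ?\<tau> = card (lr_maxima m \<sigma> \<inter> A) + (if k = 1 then 1 else 0)"
    unfolding lmaxda_def a l insert_skip_image_algebra by (rule card_insert_skip_image) (simp add: fin)
  moreover have "lmax (m + 1) ?\<tau> = lmax m \<sigma> + (if k = 1 then 1 else 0)"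
    unfolding lmax_def l by (rule card_insert_skip_image) simp
  moreover have "rmax (m + 1) ?\<tau> = rmax m \<sigma> + (if k = m + 1 then 1 else 0)"
    unfolding rmax_def r by (rule card_insert_skip_image) simp
  ultimately show ?thesis
    using maxima_positive[OF m, of \<sigma>] by (simp add: word_weight_def)
qed

text \<open>
  The seven kinds of admissible gaps. Inside the word, a gap that falls turns its right end \<open>k\<close> from
  a double descent into a peak or from a valley into a double ascent. A gap that rises turns its
  left end \<open>k - 1\<close> from a valley into a double descent or from a double ascent into a peak. Only
  a destroyed double descent may have been a right-to-left maximum, and the letters up to the top
  one are unaffected.
\<close>

lemma word_weight_insert_min_cases:
  fixes g :: "nat \<Rightarrow> nat \<Rightarrow> nat \<Rightarrow> nat \<Rightarrow> nat \<Rightarrow> nat \<Rightarrow> 'a"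
  assumes MM: "\<sigma> \<in> MM m" and m: "m \<ge> 1"
  defines "W \<equiv> \<lambda>k. word_weight g (m + 1) (insert_min m k \<sigma>)"
    and "p \<equiv> pk m \<sigma> - 1" and "a \<equiv> card (double_ascents m \<sigma> - lr_maxima m \<sigma>)"
    and "d \<equiv> card (double_descents m \<sigma> - rl_maxima m \<sigma>)"
    and "c \<equiv> lmax m \<sigma> + rmax m \<sigma> - 2"
  shows "W 1 = g p a d (rmaxdd m \<sigma>) (lmaxda m \<sigma> + 1) (c + 1)"
    and "W (m + 1) = g p a d (rmaxdd m \<sigma> + 1) (lmaxda m \<sigma>) (c + 1)"
    and "k \<in> rl_maxima m \<sigma> \<inter> double_descents m \<sigma> \<Longrightarrow>
      W k = g (p + 1) a d (rmaxdd m \<sigma> - 1) (lmaxda m \<sigma>) c"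
    and "k \<in> double_descents m \<sigma> - rl_maxima m \<sigma> \<Longrightarrow>
      W k = g (p + 1) a (d - 1) (rmaxdd m \<sigma>) (lmaxda m \<sigma>) c"
    and "k \<in> valleys m \<sigma> \<Longrightarrow> W k = g p (a + 1) d (rmaxdd m \<sigma>) (lmaxda m \<sigma>) c"
    and "k \<in> Suc ` valleys m \<sigma> \<Longrightarrow> W k = g p a (d + 1) (rmaxdd m \<sigma>) (lmaxda m \<sigma>) c"
    and "k \<in> Suc ` (double_ascents m \<sigma> - lr_maxima m \<sigma>) \<Longrightarrow>
      W k = g (p + 1) (a - 1) d (rmaxdd m \<sigma>) (lmaxda m \<sigma>) c"
proof -
  let ?r = "rises m \<sigma>"
  let ?P = "peaks m \<sigma>" and ?A = "double_ascents m \<sigma>" and ?D = "double_descents m \<sigma>"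
    and ?V = "valleys m \<sigma>" and ?L = "lr_maxima m \<sigma>" and ?R = "rl_maxima m \<sigma>"
  let ?P' = "\<lambda>k. {i \<in> {1..m}. (i = k \<or> ?r (i - 1)) \<and> \<not> (i + 1 \<noteq> k \<and> ?r i)}"
  let ?A' = "\<lambda>k. {i \<in> {1..m}. (i = k \<or> ?r (i - 1)) \<and> i + 1 \<noteq> k \<and> ?r i}"
  let ?D' = "\<lambda>k. {i \<in> {1..m}. \<not> (i = k \<or> ?r (i - 1)) \<and> \<not> (i + 1 \<noteq> k \<and> ?r i)}"
  note \<sigma> = MM_Sym[OF MM m]
  define T where "T = inv \<sigma> m"
  note top = MM_facts(2-6)[OF MM m, folded T_def]
  note P = peaks_rises[OF \<sigma>] and A = double_ascents_rises[OF \<sigma>]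
    and D = double_descents_rises[OF \<sigma>]
  note sets = P A D valleys_def
  have W: "W k = g (card (?P' k) - 1) (card (?A' k - ?L)) (card (?D' k - ?R))
      (card (?R \<inter> ?D' k) + (if k = m + 1 then 1 else 0))
      (card (?L \<inter> ?A' k) + (if k = 1 then 1 else 0))
      (c + (if k = 1 then 1 else 0) + (if k = m + 1 then 1 else 0))" if "k \<in> {1..m + 1}" for k
    unfolding W_def c_def by (rule word_weight_insert_min[OF \<sigma> m that])
  have r0: "?r 0" using rises_0[OF \<sigma> m] .
  have rm: "\<not> ?r m" by (rule not_rises_last)
  have posP: "0 < card ?P" using card_valleys[OF \<sigma> m] by (simp add: pk_def)
  have stats: "p = card ?P - 1" "rmaxdd m \<sigma> = card (?R \<inter> ?D)" "lmaxda m \<sigma> = card (?L \<inter> ?A)"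
    by (simp_all add: p_def pk_def rmaxdd_def lmaxda_def)
  have after_top: "i \<notin> ?L" if "i \<in> {1..m}" "\<not> ?r (i - 1)" for i
  proof
    assume "i \<in> ?L"
    then have "i \<le> T" "1 \<le> i" unfolding top(5) by simp_all
    then have "?r (i - 1)" using top(3)[of "i - 1"] r0 by (cases "i = 1") auto
    then show False using that by simp
  qed
  have not_rl: "i \<notin> ?R" if "i \<in> {1..m}" "?r i" for i
  proof
    assume "i \<in> ?R"
    moreover have "i < m" using that rm by (cases "i = m") auto
    ultimately have "\<sigma> (i + 1) < \<sigma> i" by (auto simp: rl_maxima_def)
    then show False using that \<open>i < m\<close> by (simp add: rises_iff)
  qed
  have "?P' 1 = ?P" "?A' 1 = ?A" "?D' 1 = ?D"
    using r0 by (auto simp: sets)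
  then show "W 1 = g p a d (rmaxdd m \<sigma>) (lmaxda m \<sigma> + 1) (c + 1)"
    using W[of 1] m by (simp add: stats a_def d_def)
  have "?P' (m + 1) = ?P" "?A' (m + 1) = ?A" "?D' (m + 1) = ?D"
    using rm by (auto simp: sets)
  then show "W (m + 1) = g p a d (rmaxdd m \<sigma> + 1) (lmaxda m \<sigma>) (c + 1)"
    using W[of "m + 1"] m by (simp add: stats a_def d_def)
  have inner: "W k = g (card (?P' k) - 1) (card (?A' k - ?L)) (card (?D' k - ?R))
      (card (?R \<inter> ?D' k)) (card (?L \<inter> ?A' k)) c" if "2 \<le> k" "k \<le> m" for k
    using W[of k] that by simp
  have fall2: "2 \<le> k" if "k \<in> {1..m}" "\<not> ?r (k - 1)" for k
    using that r0 by (cases "k = 1") auto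
  have dd: "?P' k = insert k ?P" "?A' k = ?A" "?D' k = ?D - {k}" "k \<notin> ?P" "2 \<le> k" "k \<le> m" if "k \<in> ?D" for k
  proof -
    have k: "k \<in> {1..m}" "\<not> ?r (k - 1)" "\<not> ?r k" using that by (auto simp: D)
    have nk: "i + 1 = k \<Longrightarrow> \<not> ?r i" for i using k(2) by auto
    show "?P' k = insert k ?P" "?A' k = ?A" "?D' k = ?D - {k}" "k \<notin> ?P"
      using k nk by (auto simp: sets)
    show "2 \<le> k" "k \<le> m" using fall2[OF k(1,2)] k(1) by auto
  qed
  show "W k = g (p + 1) a d (rmaxdd m \<sigma> - 1) (lmaxda m \<sigma>) c" if k: "k \<in> ?R \<inter> ?D"
  proof -
    have kD: "k \<in> ?D" using k by simp
    have "?D - {k} - ?R = ?D - ?R" "?R \<inter> (?D - {k}) = ?R \<inter> ?D - {k}" using k by auto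
    then show ?thesis
      using inner[OF dd(5,6)[OF kD]] dd(1-4)[OF kD] k posP by (simp add: stats a_def d_def)
  qed
  show "W k = g (p + 1) a (d - 1) (rmaxdd m \<sigma>) (lmaxda m \<sigma>) c" if k: "k \<in> ?D - ?R"
  proof -
    have kD: "k \<in> ?D" using k by simp
    have "?D - {k} - ?R = ?D - ?R - {k}" "?R \<inter> (?D - {k}) = ?R \<inter> ?D" using k by auto
    then show ?thesis
      using inner[OF dd(5,6)[OF kD]] dd(1-4)[OF kD] k posP by (simp add: stats a_def d_def)
  qed
  show "W k = g p (a + 1) d (rmaxdd m \<sigma>) (lmaxda m \<sigma>) c" if "k \<in> ?V"
  proof -
    have k: "k \<in> {1..m}" "\<not> ?r (k - 1)" "?r k" using that by (auto simp: valleys_def)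
    have nk: "i + 1 = k \<Longrightarrow> \<not> ?r i" for i using k(2) by auto
    have eq: "?P' k = ?P" "?A' k = insert k ?A" "?D' k = ?D" "k \<notin> ?A"
      using k nk by (auto simp: sets)
    have "insert k ?A - ?L = insert k (?A - ?L)" "?L \<inter> insert k ?A = ?L \<inter> ?A"
      using after_top[OF k(1,2)] by auto
    then show ?thesis
      using inner[OF fall2[OF k(1,2)]] k(1) eq by (simp add: stats a_def d_def)
  qed
  show "W k = g p a (d + 1) (rmaxdd m \<sigma>) (lmaxda m \<sigma>) c" if k: "k \<in> Suc ` ?V"
  proof -
    obtain l where kl: "k = l + 1" "l \<in> ?V" using k by auto
    then have l: "l \<in> {1..m}" "\<not> ?r (l - 1)" "?r l" by (auto simp: valleys_def)
    have nk: "i = k \<Longrightarrow> ?r (i - 1)" for i using kl l(3) by simp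
    have eq: "?P' k = ?P" "?A' k = ?A" "?D' k = insert l ?D" "l \<notin> ?D"
      using l nk kl(1) by (auto simp: sets)
    have "insert l ?D - ?R = insert l (?D - ?R)" "?R \<inter> insert l ?D = ?R \<inter> ?D"
      using not_rl[OF l(1,3)] by auto
    moreover have "2 \<le> k" "k \<le> m" using l rm kl(1) by (auto simp: le_less)
    ultimately show ?thesis
      using inner[of k] eq by (simp add: stats a_def d_def)
  qed
  show "W k = g (p + 1) (a - 1) d (rmaxdd m \<sigma>) (lmaxda m \<sigma>) c" if k: "k \<in> Suc ` (?A - ?L)"
  proof -
    obtain l where kl: "k = l + 1" "l \<in> ?A" "l \<notin> ?L" using k by auto
    then have l: "l \<in> {1..m}" "?r (l - 1)" "?r l" by (auto simp: A)
    have nk: "i = k \<Longrightarrow> ?r (i - 1)" for i using kl l(3) by simp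
    have eq: "?P' k = insert l ?P" "?A' k = ?A - {l}" "?D' k = ?D" "l \<notin> ?P"
      using l nk kl(1) by (auto simp: sets)
    have "?A - {l} - ?L = ?A - ?L - {l}" "?L \<inter> (?A - {l}) = ?L \<inter> ?A"
      using kl(3) by auto
    moreover have "2 \<le> k" "k \<le> m" using l rm kl(1) by (auto simp: le_less)
    ultimately show ?thesis
      using inner[of k] eq posP kl by (simp add: stats a_def d_def)
  qed
qed

text \<open>
  Every gap to the right of the top letter is indexed by its smaller end: a double descent or a
  valley if the gap falls, a valley or a double ascent if it rises. Double ascents that are
  left-to-right maxima lie before the top letter and bound no admissible gap from the left.
\<close>

lemma sum_min_slots:
  assumes MM: "\<sigma> \<in> MM m" and m: "m \<ge> 1"
  shows "sum G (min_slots m \<sigma>) = G 1 + G (m + 1)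
    + sum G (rl_maxima m \<sigma> \<inter> double_descents m \<sigma>) + sum G (double_descents m \<sigma> - rl_maxima m \<sigma>)
    + sum G (valleys m \<sigma>) + sum G (Suc ` valleys m \<sigma>)
    + sum G (Suc ` (double_ascents m \<sigma> - lr_maxima m \<sigma>))"
proof -
  let ?r = "rises m \<sigma>"
  let ?A = "double_ascents m \<sigma>" and ?D = "double_descents m \<sigma>"
    and ?V = "valleys m \<sigma>" and ?L = "lr_maxima m \<sigma>" and ?R = "rl_maxima m \<sigma>"
  note \<sigma> = MM_Sym[OF MM m]
  define T where "T = inv \<sigma> m"
  note top = MM_facts(2-6)[OF MM m, folded T_def]
  have T: "1 \<le> T" "T \<le> m" using top(1) by auto
  have r0: "?r 0" using rises_0[OF \<sigma> m] .
  have rm: "\<not> ?r m" by (rule not_rises_last)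
  have fall: "?D \<union> ?V = {k \<in> {T<..m}. \<not> ?r (k - 1)}"
  proof (rule set_eqI)
    fix k
    have "T < k" if "1 \<le> k" "\<not> ?r (k - 1)"
    proof (rule ccontr)
      assume "\<not> T < k"
      moreover have "k \<noteq> 1" using that(2) r0 by auto
      ultimately have "1 \<le> k - 1" "k - 1 < T" using that(1) by auto
      then show False using that(2) top(3) by blast
    qed
    then show "k \<in> ?D \<union> ?V \<longleftrightarrow> k \<in> {k \<in> {T<..m}. \<not> ?r (k - 1)}"
      using T by (auto simp: double_descents_rises[OF \<sigma>] valleys_def)
  qed
  have rise: "Suc ` ?V \<union> Suc ` (?A - ?L) = {k \<in> {T<..m}. ?r (k - 1)}"
  proof (rule set_eqI)
    fix k
    show "k \<in> Suc ` ?V \<union> Suc ` (?A - ?L) \<longleftrightarrow> k \<in> {k \<in> {T<..m}. ?r (k - 1)}"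
    proof (cases k)
      case (Suc l)
      have "l \<in> ?V \<union> (?A - ?L) \<longleftrightarrow> T < l \<and> l < m \<and> ?r l"
      proof
        assume l: "l \<in> ?V \<union> (?A - ?L)"
        then have "?r l" "l \<in> {1..m}" by (auto simp: double_ascents_rises[OF \<sigma>] valleys_def)
        moreover have "T < l"
          using l
        proof
          assume "l \<in> ?V"
          then have "l \<in> ?D \<union> ?V" by simp
          then show ?thesis unfolding fall by simp
        next
          assume "l \<in> ?A - ?L"
          then show ?thesis using \<open>l \<in> {1..m}\<close> unfolding top(5) by simp
        qed
        moreover have "l \<noteq> m" using \<open>?r l\<close> rm by auto
        ultimately show "T < l \<and> l < m \<and> ?r l" by simp
      next
        assume "T < l \<and> l < m \<and> ?r l"
        then show "l \<in> ?V \<union> (?A - ?L)"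
          using T unfolding top(5) by (auto simp: double_ascents_rises[OF \<sigma>] valleys_def)
      qed
      moreover have "T < Suc l \<and> ?r l \<longleftrightarrow> T < l \<and> ?r l" using top(4) by (auto simp: less_Suc_eq)
      ultimately show ?thesis unfolding Suc by (auto simp: image_iff)
    qed auto
  qed
  have disj: "?V \<inter> ?A = {}" "?D \<inter> ?V = {}"
    by (auto simp: double_ascents_rises[OF \<sigma>] double_descents_rises[OF \<sigma>] valleys_def)
  have "min_slots m \<sigma> = insert 1 (insert (m + 1) {T<..m})"
    using T by (auto simp: min_slots_def T_def[symmetric])
  then have "sum G (min_slots m \<sigma>) = G 1 + (G (m + 1) + sum G {T<..m})"
    using T by simp
  also have "{T<..m} = (?D \<union> ?V) \<union> (Suc ` ?V \<union> Suc ` (?A - ?L))"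
    unfolding fall rise by auto
  also have "sum G \<dots> = sum G (?D \<union> ?V) + sum G (Suc ` ?V \<union> Suc ` (?A - ?L))"
    by (rule sum.union_disjoint) (simp_all, unfold fall rise, auto)
  also have "sum G (?D \<union> ?V) = sum G ?D + sum G ?V"
    by (rule sum.union_disjoint) (use disj in auto)
  also have "sum G (Suc ` ?V \<union> Suc ` (?A - ?L)) = sum G (Suc ` ?V) + sum G (Suc ` (?A - ?L))"
    by (rule sum.union_disjoint) (use disj in auto)
  also have "sum G ?D = sum G (?R \<inter> ?D) + sum G (?D - ?R)"
    by (subst sum.union_disjoint[symmetric]) (auto intro: arg_cong[of _ _ "sum G"])
  finally show ?thesis by (simp only: add.assoc)
qed

lemma sum_word_weight_Suc:
  fixes g :: "nat \<Rightarrow> nat \<Rightarrow> nat \<Rightarrow> nat \<Rightarrow> nat \<Rightarrow> nat \<Rightarrow> 'a::comm_semiring_1"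
  assumes m: "m \<ge> 1"
  shows "(\<Sum>\<tau>\<in>MM (m + 1). word_weight g (m + 1) \<tau>) = (\<Sum>\<sigma>\<in>MM m. word_weight (word_insertion g) m \<sigma>)"
  unfolding sum_MM_Suc[OF m]
proof (rule sum.cong[OF refl])
  fix \<sigma> assume \<sigma>: "\<sigma> \<in> MM m"
  let ?A = "double_ascents m \<sigma> - lr_maxima m \<sigma>" and ?D = "double_descents m \<sigma> - rl_maxima m \<sigma>"
    and ?V = "valleys m \<sigma>" and ?R = "rl_maxima m \<sigma> \<inter> double_descents m \<sigma>"
  let ?W = "\<lambda>k. word_weight g (m + 1) (insert_min m k \<sigma>)"
  let ?v = "\<lambda>p a d i. g p a d i (lmaxda m \<sigma>) (lmax m \<sigma> + rmax m \<sigma> - 2)"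
  have const: "sum ?W X = of_nat (card X) * x" if "\<And>k. k \<in> X \<Longrightarrow> ?W k = x" for X x
    using that by simp
  note w = word_weight_insert_min_cases[OF \<sigma> m, where g = g]
  have sums:
    "sum ?W ?R = of_nat (card ?R) * ?v (pk m \<sigma> - 1 + 1) (card ?A) (card ?D) (rmaxdd m \<sigma> - 1)"
    "sum ?W ?D = of_nat (card ?D) * ?v (pk m \<sigma> - 1 + 1) (card ?A) (card ?D - 1) (rmaxdd m \<sigma>)"
    "sum ?W ?V = of_nat (card ?V) * ?v (pk m \<sigma> - 1) (card ?A + 1) (card ?D) (rmaxdd m \<sigma>)"
    "sum ?W (Suc ` ?V) = of_nat (card (Suc ` ?V)) * ?v (pk m \<sigma> - 1) (card ?A) (card ?D + 1) (rmaxdd m \<sigma>)"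
    "sum ?W (Suc ` ?A) = of_nat (card (Suc ` ?A)) * ?v (pk m \<sigma> - 1 + 1) (card ?A - 1) (card ?D) (rmaxdd m \<sigma>)"
    by (rule const, erule w)+
  have cards: "card (Suc ` ?V) = pk m \<sigma> - 1" "card (Suc ` ?A) = card ?A" "card ?V = pk m \<sigma> - 1"
      "card ?R = rmaxdd m \<sigma>"
    using card_valleys[OF MM_Sym[OF \<sigma> m] m] by (simp_all add: card_image rmaxdd_def)
  show "(\<Sum>k\<in>min_slots m \<sigma>. ?W k) = word_weight (word_insertion g) m \<sigma>"
    unfolding sum_min_slots[OF \<sigma> m] sums w(1,2) cards
    by (simp only: word_weight_def word_insertion_def distrib_left ac_simps)
qed

section \<open>From words to cycles to the merged model\<close>

text \<open>
  Summing against \<open>s choose a\<close> commutes with insertion, so the recurrence descends to the merged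
  model.
\<close>

lemma sum_Sym_eq_merged_total:
  "(\<Sum>\<sigma>\<in>Sym n. cyclic_weight f n \<sigma>)
   = merged_total n (\<lambda>p s z c. binomial_sum s (\<lambda>a d. f p a d z c))"
proof (induction n arbitrary: f)
  case 0
  show ?case
    by (simp add: Sym_def cyclic_weight_def cpk_def cda_def cdd_def fixs_def cyc_def binomial_sum_def)
next
  case (Suc n)
  have "merged_insertion (\<lambda>p s z c. binomial_sum s (\<lambda>a d. f p a d z c))
     = (\<lambda>p s z c. binomial_sum s (\<lambda>a d. cycle_insertion f p a d z c))"
    by (intro ext) (simp add: binomial_sum_cycle_insertion)
  then show ?case by (simp add: sum_cyclic_weight_Suc Suc.IH)
qed

text \<open>
  Both sides obey the same recurrence, as painting the fixed points intertwines the two insertion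
  operators. The words of length \<open>n + 1\<close> correspond to the permutations of \<open>[n]\<close> because the top
  letter only marks where the initial run ends.
\<close>

lemma sum_MM_eq_sum_Sym:
  "(\<Sum>\<sigma>\<in>MM (n + 1). word_weight g (n + 1) \<sigma>)
   = (\<Sum>\<sigma>\<in>Sym n. cyclic_weight (\<lambda>p a d z c. binomial_sum z (\<lambda>i k. g p a d i k c)) n \<sigma>)"
proof (induction n arbitrary: g)
  case 0
  have MM1: "MM 1 = {id}" by (auto simp: MM_def Sym_def)
  have sets: "peaks 1 id = {1}" "double_ascents 1 id = {}" "double_descents 1 id = {}"
    "lr_maxima 1 id = {1}" "rl_maxima 1 id = {1}"
    by (auto simp: peaks_def double_ascents_def double_descents_def lr_maxima_def rl_maxima_def letter_def)
  have "word_weight g 1 id = g 0 0 0 0 0 0"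
    by (simp add: word_weight_def pk_def rmaxdd_def lmaxda_def lmax_def rmax_def sets[simplified])
  moreover have "Sym 0 = {id}" by (simp add: Sym_def)
  moreover from calculation have "word_weight g 1 (\<lambda>i. i) = g 0 0 0 0 0 0" by (simp only: id_def)
  ultimately show ?case
    using MM1 by (simp add: cyclic_weight_def cpk_def cda_def cdd_def fixs_def cyc_def binomial_sum_def)
next
  case (Suc n)
  let ?\<Phi> = "\<lambda>g p a d z c. binomial_sum z (\<lambda>i k. g p a d i k c)"
  have comm: "?\<Phi> (word_insertion g) = cycle_insertion (?\<Phi> g)"
    by (intro ext) (rule binomial_sum_word_insertion)
  have "(\<Sum>\<sigma>\<in>MM (Suc n + 1). word_weight g (Suc n + 1) \<sigma>)
      = (\<Sum>\<sigma>\<in>MM (n + 1). word_weight (word_insertion g) (n + 1) \<sigma>)"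
    using sum_word_weight_Suc[of "n + 1" g] by simp
  also have "\<dots> = (\<Sum>\<sigma>\<in>Sym n. cyclic_weight (?\<Phi> (word_insertion g)) n \<sigma>)"
    by (rule Suc.IH)
  also have "\<dots> = (\<Sum>\<sigma>\<in>Sym n. cyclic_weight (cycle_insertion (?\<Phi> g)) n \<sigma>)"
    by (simp only: comm)
  also have "\<dots> = (\<Sum>\<sigma>\<in>Sym (Suc n). cyclic_weight (?\<Phi> g) (Suc n) \<sigma>)"
    by (rule sum_cyclic_weight_Suc[symmetric])
  finally show ?case .
qed

section \<open>The gamma coefficients\<close>

definition peak_term :: "nat \<Rightarrow> 'a \<Rightarrow> 'a \<Rightarrow> nat \<Rightarrow> nat \<Rightarrow> nat \<Rightarrow> nat \<Rightarrow> 'a::comm_semiring_1" where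
  "peak_term j \<alpha> t p s z c = (if p = j then \<alpha> ^ c * t ^ z else 0)"

text \<open>
  The coefficient \<open>\<gamma>\<^sub>j\<close>, described without any choice of double ascents or double descents.
\<close>

definition gamma_coeff :: "nat \<Rightarrow> nat \<Rightarrow> 'a \<Rightarrow> 'a \<Rightarrow> 'a::comm_semiring_1" where
  "gamma_coeff n j \<alpha> t = merged_total n (peak_term j \<alpha> t)"

text \<open>
  Without cyclic double ascents, all \<open>s\<close> points are cyclic double descents, in a single way, and
  the excedances are counted by the cyclic peaks alone.
\<close>

lemma gamma_eq_no_cda:
  "gamma_coeff n j \<alpha> t = (\<Sum>\<sigma> | \<sigma> \<in> Sym n \<and> cda n \<sigma> = 0 \<and> exc n \<sigma> = j. \<alpha> ^ cyc n \<sigma> * t ^ fixs n \<sigma>)"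
proof -
  let ?f = "\<lambda>p a d z c. if a = 0 then peak_term j \<alpha> t p d z c else 0"
  have "gamma_coeff n j \<alpha> t = (\<Sum>\<sigma>\<in>Sym n. cyclic_weight ?f n \<sigma>)"
    unfolding gamma_coeff_def sum_Sym_eq_merged_total binomial_sum_left_zero ..
  also have "\<dots> = (\<Sum>\<sigma>\<in>Sym n. if cda n \<sigma> = 0 \<and> exc n \<sigma> = j then \<alpha> ^ cyc n \<sigma> * t ^ fixs n \<sigma> else 0)"
    by (intro sum.cong refl) (auto simp: cyclic_weight_def peak_term_def exc_eq)
  also have "\<dots> = (\<Sum>\<sigma> | \<sigma> \<in> Sym n \<and> cda n \<sigma> = 0 \<and> exc n \<sigma> = j. \<alpha> ^ cyc n \<sigma> * t ^ fixs n \<sigma>)"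
    by (rule sum.inter_filter[symmetric]) simp
  finally show ?thesis .
qed

lemma gamma_eq_no_cdd:
  "gamma_coeff n j \<alpha> t = (\<Sum>\<sigma> | \<sigma> \<in> Sym n \<and> cdd n \<sigma> = 0 \<and> drops n \<sigma> = j. \<alpha> ^ cyc n \<sigma> * t ^ fixs n \<sigma>)"
proof -
  let ?f = "\<lambda>p a d z c. if d = 0 then peak_term j \<alpha> t p a z c else 0"
  have "gamma_coeff n j \<alpha> t = (\<Sum>\<sigma>\<in>Sym n. cyclic_weight ?f n \<sigma>)"
    unfolding gamma_coeff_def sum_Sym_eq_merged_total binomial_sum_right_zero ..
  also have "\<dots> = (\<Sum>\<sigma>\<in>Sym n. if cdd n \<sigma> = 0 \<and> drops n \<sigma> = j then \<alpha> ^ cyc n \<sigma> * t ^ fixs n \<sigma> else 0)"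
    by (intro sum.cong refl) (auto simp: cyclic_weight_def peak_term_def drops_eq)
  also have "\<dots> = (\<Sum>\<sigma> | \<sigma> \<in> Sym n \<and> cdd n \<sigma> = 0 \<and> drops n \<sigma> = j. \<alpha> ^ cyc n \<sigma> * t ^ fixs n \<sigma>)"
    by (rule sum.inter_filter[symmetric]) simp
  finally show ?thesis .
qed

text \<open>
  Forbidding double ascents also forbids the second kind of fixed point, so that both colourings
  are trivial and the word starts with its top letter.
\<close>

lemma gamma_eq_no_da:
  "gamma_coeff n j \<alpha> t = (\<Sum>\<sigma> | \<sigma> \<in> MM (n + 1) \<and> da (n + 1) \<sigma> = 0 \<and> asc (n + 1) \<sigma> = j.
     \<alpha> ^ (rmax (n + 1) \<sigma> - 1) * t ^ rmaxdd (n + 1) \<sigma>)"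
proof -
  let ?m = "n + 1"
  let ?g = "\<lambda>p a d i k c. if k = 0 then (if a = 0 then peak_term j \<alpha> t p d i c else 0) else 0"
  have "gamma_coeff n j \<alpha> t = (\<Sum>\<sigma>\<in>MM ?m. word_weight ?g ?m \<sigma>)"
    unfolding gamma_coeff_def sum_MM_eq_sum_Sym sum_Sym_eq_merged_total
      binomial_sum_right_zero binomial_sum_left_zero ..
  also have "\<dots> = (\<Sum>\<sigma>\<in>MM ?m. if da ?m \<sigma> = 0 \<and> asc ?m \<sigma> = j
      then \<alpha> ^ (rmax ?m \<sigma> - 1) * t ^ rmaxdd ?m \<sigma> else 0)"
  proof (rule sum.cong[OF refl])
    fix \<sigma> assume MM: "\<sigma> \<in> MM ?m"
    have m: "?m \<ge> 1" by simp
    note \<sigma> = MM_Sym[OF MM m]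
    show "word_weight ?g ?m \<sigma> = (if da ?m \<sigma> = 0 \<and> asc ?m \<sigma> = j
      then \<alpha> ^ (rmax ?m \<sigma> - 1) * t ^ rmaxdd ?m \<sigma> else 0)"
      using lmax_MM[OF MM m] card_valleys[OF \<sigma> m] asc_eq[OF \<sigma> m] da_split[of ?m \<sigma>]
      by (auto simp: word_weight_def peak_term_def)
  qed
  also have "\<dots> = (\<Sum>\<sigma> | \<sigma> \<in> MM ?m \<and> da ?m \<sigma> = 0 \<and> asc ?m \<sigma> = j.
      \<alpha> ^ (rmax ?m \<sigma> - 1) * t ^ rmaxdd ?m \<sigma>)"
    by (rule sum.inter_filter[symmetric]) simp
  finally show ?thesis .
qed

text \<open>
  Forbidding double descents leaves only the left-to-right maxima as fixed points. The
  surviving colours are those opposite to the case without double ascents.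
\<close>

lemma gamma_eq_no_dd:
  "gamma_coeff n j \<alpha> t = (\<Sum>\<sigma> | \<sigma> \<in> MM (n + 1) \<and> dd (n + 1) \<sigma> = 0 \<and> des (n + 1) \<sigma> = j.
     \<alpha> ^ (lmax (n + 1) \<sigma> + rmax (n + 1) \<sigma> - 2) * t ^ lmaxda (n + 1) \<sigma>)"
proof -
  let ?m = "n + 1"
  let ?g = "\<lambda>p a d i k c. if i = 0 then (if d = 0 then peak_term j \<alpha> t p a k c else 0) else 0"
  have "gamma_coeff n j \<alpha> t = (\<Sum>\<sigma>\<in>MM ?m. word_weight ?g ?m \<sigma>)"
    unfolding gamma_coeff_def sum_MM_eq_sum_Sym sum_Sym_eq_merged_total
      binomial_sum_left_zero binomial_sum_right_zero ..
  also have "\<dots> = (\<Sum>\<sigma>\<in>MM ?m. if dd ?m \<sigma> = 0 \<and> des ?m \<sigma> = j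
      then \<alpha> ^ (lmax ?m \<sigma> + rmax ?m \<sigma> - 2) * t ^ lmaxda ?m \<sigma> else 0)"
  proof (rule sum.cong[OF refl])
    fix \<sigma> assume MM: "\<sigma> \<in> MM ?m"
    have m: "?m \<ge> 1" by simp
    note \<sigma> = MM_Sym[OF MM m]
    show "word_weight ?g ?m \<sigma> = (if dd ?m \<sigma> = 0 \<and> des ?m \<sigma> = j
      then \<alpha> ^ (lmax ?m \<sigma> + rmax ?m \<sigma> - 2) * t ^ lmaxda ?m \<sigma> else 0)"
      using card_valleys[OF \<sigma> m] des_eq[OF \<sigma> m] dd_split[of ?m \<sigma>]
      by (auto simp: word_weight_def peak_term_def)
  qed
  also have "\<dots> = (\<Sum>\<sigma> | \<sigma> \<in> MM ?m \<and> dd ?m \<sigma> = 0 \<and> des ?m \<sigma> = j.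
      \<alpha> ^ (lmax ?m \<sigma> + rmax ?m \<sigma> - 2) * t ^ lmaxda ?m \<sigma>)"
    by (rule sum.inter_filter[symmetric]) simp
  finally show ?thesis .
qed

text \<open>
  Each of the \<open>s\<close> points is freely a double ascent or a double descent, and each fixed point brings
  its own factor 2.
\<close>

lemma gamma_cyclic_peaks:
  assumes "2 * j \<le> n"
  shows "2 ^ (n - 2 * j) * gamma_coeff n j \<alpha> t
    = (\<Sum>\<sigma> | \<sigma> \<in> Sym n \<and> cpk n \<sigma> = j. \<alpha> ^ cyc n \<sigma> * (2 * t) ^ fixs n \<sigma>)"
proof -
  let ?f = "\<lambda>p a d z c. if p = j then \<alpha> ^ c * (2 * t) ^ z else 0"
  have "(\<Sum>\<sigma> | \<sigma> \<in> Sym n \<and> cpk n \<sigma> = j. \<alpha> ^ cyc n \<sigma> * (2 * t) ^ fixs n \<sigma>)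
      = (\<Sum>\<sigma>\<in>Sym n. cyclic_weight ?f n \<sigma>)"
    unfolding cyclic_weight_def by (rule sum.inter_filter) simp
  also have "\<dots> = merged_total n (\<lambda>p s z c. 2 ^ s * (if p = j then \<alpha> ^ c * (2 * t) ^ z else 0))"
    unfolding sum_Sym_eq_merged_total binomial_sum_const ..
  also have "\<dots> = merged_total n (\<lambda>p s z c. \<Sum>i\<in>{j}. peak_term i \<alpha> t p s z c * 2 ^ (n - 2 * i))"
  proof (rule merged_total_cong)
    fix p s z c :: nat
    assume "2 * p + s + z = n"
    then have "n - 2 * p = s + z" by simp
    then show "2 ^ s * (if p = j then \<alpha> ^ c * (2 * t) ^ z else 0)
        = (\<Sum>i\<in>{j}. peak_term i \<alpha> t p s z c * 2 ^ (n - 2 * i))"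
      by (auto simp: peak_term_def power_mult_distrib power_add ac_simps)
  qed
  also have "\<dots> = 2 ^ (n - 2 * j) * gamma_coeff n j \<alpha> t"
    unfolding merged_total_sum by (simp add: gamma_coeff_def mult.commute)
  finally show ?thesis ..
qed

text \<open>
  The factor 2 at each fixed point counts its two colours.
\<close>

lemma sum_MM_peaks_eq_sum_Sym_cyclic_peaks:
  fixes \<alpha> t :: "'a::comm_semiring_1"
  shows "(\<Sum>\<sigma> | \<sigma> \<in> MM (n + 1) \<and> pk (n + 1) \<sigma> = j + 1.
      \<alpha> ^ (lmax (n + 1) \<sigma> + rmax (n + 1) \<sigma> - 2) * t ^ (lmaxda (n + 1) \<sigma> + rmaxdd (n + 1) \<sigma>))
   = (\<Sum>\<sigma> | \<sigma> \<in> Sym n \<and> cpk n \<sigma> = j. \<alpha> ^ cyc n \<sigma> * (2 * t) ^ fixs n \<sigma>)"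
proof -
  let ?m = "n + 1"
  let ?g = "\<lambda>p a d i k c. if p = j then \<alpha> ^ c * t ^ (k + i) else 0"
  have "(\<Sum>\<sigma> | \<sigma> \<in> MM ?m \<and> pk ?m \<sigma> = j + 1.
      \<alpha> ^ (lmax ?m \<sigma> + rmax ?m \<sigma> - 2) * t ^ (lmaxda ?m \<sigma> + rmaxdd ?m \<sigma>))
    = (\<Sum>\<sigma>\<in>MM ?m. if pk ?m \<sigma> = j + 1 then
      \<alpha> ^ (lmax ?m \<sigma> + rmax ?m \<sigma> - 2) * t ^ (lmaxda ?m \<sigma> + rmaxdd ?m \<sigma>) else 0)"
    by (rule sum.inter_filter) simp
  also have "\<dots> = (\<Sum>\<sigma>\<in>MM ?m. word_weight ?g ?m \<sigma>)"
  proof (rule sum.cong[OF refl])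
    fix \<sigma> assume "\<sigma> \<in> MM ?m"
    then have "pk ?m \<sigma> \<ge> 1" using card_valleys[OF MM_Sym, of \<sigma> ?m] by simp
    then have "pk ?m \<sigma> - 1 = j \<longleftrightarrow> pk ?m \<sigma> = j + 1" by auto
    then show "(if pk ?m \<sigma> = j + 1 then
      \<alpha> ^ (lmax ?m \<sigma> + rmax ?m \<sigma> - 2) * t ^ (lmaxda ?m \<sigma> + rmaxdd ?m \<sigma>) else 0)
      = word_weight ?g ?m \<sigma>"
      by (simp add: word_weight_def)
  qed
  also have "\<dots> = (\<Sum>\<sigma>\<in>Sym n. cyclic_weight
      (\<lambda>p a d z c. binomial_sum z (\<lambda>i k. if p = j then \<alpha> ^ c * t ^ (k + i) else 0)) n \<sigma>)"
    by (rule sum_MM_eq_sum_Sym)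
  also have "(\<lambda>p a d z c. binomial_sum z (\<lambda>i k. if p = j then \<alpha> ^ c * t ^ (k + i) else 0))
      = (\<lambda>p (a::nat) (d::nat) z c. if p = j then \<alpha> ^ c * (2 * t) ^ z else 0)"
  proof (intro ext)
    fix p a d z c :: nat
    have "binomial_sum z (\<lambda>i k. if p = j then \<alpha> ^ c * t ^ (k + i) else 0)
        = binomial_sum z (\<lambda>i k. if p = j then \<alpha> ^ c * t ^ z else 0)"
      by (rule binomial_sum_cong) (auto simp: add.commute)
    then show "binomial_sum z (\<lambda>i k. if p = j then \<alpha> ^ c * t ^ (k + i) else 0)
        = (if p = j then \<alpha> ^ c * (2 * t) ^ z else 0)"
      by (simp add: binomial_sum_const power_mult_distrib ac_simps)
  qed
  also have "(\<Sum>\<sigma>\<in>Sym n. cyclic_weight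
        (\<lambda>p (a::nat) (d::nat) z c. if p = j then \<alpha> ^ c * (2 * t) ^ z else 0) n \<sigma>)
      = (\<Sum>\<sigma> | \<sigma> \<in> Sym n \<and> cpk n \<sigma> = j. \<alpha> ^ cyc n \<sigma> * (2 * t) ^ fixs n \<sigma>)"
    unfolding cyclic_weight_def by (rule sum.inter_filter[symmetric]) simp
  finally show ?thesis .
qed

text \<open>
  A rise or fall is charged to the letter it starts from or ends in, so that \<open>asc\<close> counts double
  ascents and valleys and \<open>des\<close> counts double descents and valleys. The binomial theorem is then
  applied once for each of the two colourings.
\<close>

lemma binomial_Eulerian_gamma_expansion:
  "binomial_Eulerian n x y t \<alpha>
    = (\<Sum>j = 0..n div 2. gamma_coeff n j \<alpha> t * (x * y) ^ j * (x + y) ^ (n - 2 * j))"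
proof -
  let ?m = "n + 1"
  let ?g = "\<lambda>p a d i k c. x ^ (a + k + p) * y ^ (d + i + p) * t ^ (k + i) * \<alpha> ^ c"
  have "binomial_Eulerian n x y t \<alpha> = (\<Sum>\<sigma>\<in>MM ?m. word_weight ?g ?m \<sigma>)"
    unfolding binomial_Eulerian_def
  proof (rule sum.cong[OF refl])
    fix \<sigma> assume MM: "\<sigma> \<in> MM ?m"
    have m: "?m \<ge> 1" by simp
    note \<sigma> = MM_Sym[OF MM m]
    show "x ^ asc ?m \<sigma> * y ^ des ?m \<sigma> * t ^ (lmaxda ?m \<sigma> + rmaxdd ?m \<sigma>)
        * \<alpha> ^ (lmax ?m \<sigma> + rmax ?m \<sigma> - 2) = word_weight ?g ?m \<sigma>"
      using card_valleys[OF \<sigma> m] asc_eq[OF \<sigma> m] des_eq[OF \<sigma> m] da_split[of ?m \<sigma>] dd_split[of ?m \<sigma>]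
      by (simp add: word_weight_def)
  qed
  also have "\<dots> = merged_total n (\<lambda>p s z c. binomial_sum s (\<lambda>a d. binomial_sum z (\<lambda>i k. ?g p a d i k c)))"
    by (simp only: sum_MM_eq_sum_Sym sum_Sym_eq_merged_total)
  also have "\<dots> = merged_total n (\<lambda>p s z c.
      \<Sum>j = 0..n div 2. peak_term j \<alpha> t p s z c * ((x * y) ^ j * (x + y) ^ (n - 2 * j)))"
  proof (rule merged_total_cong)
    fix p s z c :: nat
    assume n: "2 * p + s + z = n"
    \<comment> \<open>A fixed point is a double ascent (weight \<open>x\<close>) or a double descent (weight \<open>y\<close>) of the word.\<close>
    have inner: "binomial_sum z (\<lambda>i k. ?g p a d i k c)
        = (x * y) ^ p * t ^ z * \<alpha> ^ c * (x + y) ^ z * (x ^ a * y ^ d)" for a d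
    proof -
      have "binomial_sum z (\<lambda>i k. ?g p a d i k c)
          = binomial_sum z (\<lambda>i k. (x ^ (a + p) * y ^ (d + p) * t ^ z * \<alpha> ^ c) * (y ^ i * x ^ k))"
        by (rule binomial_sum_cong) (simp add: power_add ac_simps)
      also have "\<dots> = (x ^ (a + p) * y ^ (d + p) * t ^ z * \<alpha> ^ c) * (y + x) ^ z"
        by (simp only: binomial_sum_cmult binomial_sum_powers)
      finally show ?thesis by (simp add: power_add power_mult_distrib ac_simps)
    qed
    have "binomial_sum s (\<lambda>a d. binomial_sum z (\<lambda>i k. ?g p a d i k c))
        = (x * y) ^ p * t ^ z * \<alpha> ^ c * (x + y) ^ z * (x + y) ^ s"
      by (simp only: inner binomial_sum_cmult binomial_sum_powers)
    moreover have "n - 2 * p = s + z" "p \<le> n div 2" using n by auto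
    moreover have "(\<Sum>j = 0..n div 2. peak_term j \<alpha> t p s z c * ((x * y) ^ j * (x + y) ^ (n - 2 * j)))
        = (\<Sum>j = 0..n div 2. if p = j then \<alpha> ^ c * t ^ z * ((x * y) ^ j * (x + y) ^ (n - 2 * j)) else 0)"
      by (rule sum.cong) (auto simp: peak_term_def)
    ultimately show "binomial_sum s (\<lambda>a d. binomial_sum z (\<lambda>i k. ?g p a d i k c))
        = (\<Sum>j = 0..n div 2. peak_term j \<alpha> t p s z c * ((x * y) ^ j * (x + y) ^ (n - 2 * j)))"
      by (simp add: power_add ac_simps)
  qed
  finally show ?thesis
    by (simp only: merged_total_sum gamma_coeff_def mult.assoc)
qed

theorem theorem2p5:
  fixes n :: nat
  assumes "n \<ge> 1"
  shows "\<exists>\<gamma> :: nat \<Rightarrow> 'a \<Rightarrow> 'a \<Rightarrow> 'a::field_char_0.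
    (\<forall>x y t \<alpha>. binomial_Eulerian n x y t \<alpha> =
        (\<Sum>j = 0..n div 2. \<gamma> j \<alpha> t * (x * y) ^ j * (x + y) ^ (n - 2 * j)))
    \<and> (\<forall>j \<le> n div 2. \<forall>\<alpha> t.
        \<gamma> j \<alpha> t = (\<Sum>\<sigma> | \<sigma> \<in> MM (n + 1) \<and> da (n + 1) \<sigma> = 0 \<and> asc (n + 1) \<sigma> = j.
            \<alpha> ^ (rmax (n + 1) \<sigma> - 1) * t ^ rmaxdd (n + 1) \<sigma>)
      \<and> \<gamma> j \<alpha> t = (\<Sum>\<sigma> | \<sigma> \<in> Sym n \<and> cda n \<sigma> = 0 \<and> exc n \<sigma> = j.
            \<alpha> ^ cyc n \<sigma> * t ^ fixs n \<sigma>)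
      \<and> \<gamma> j \<alpha> t = (\<Sum>\<sigma> | \<sigma> \<in> MM (n + 1) \<and> dd (n + 1) \<sigma> = 0 \<and> des (n + 1) \<sigma> = j.
            \<alpha> ^ (lmax (n + 1) \<sigma> + rmax (n + 1) \<sigma> - 2) * t ^ lmaxda (n + 1) \<sigma>)
      \<and> \<gamma> j \<alpha> t = (\<Sum>\<sigma> | \<sigma> \<in> Sym n \<and> cdd n \<sigma> = 0 \<and> drops n \<sigma> = j.
            \<alpha> ^ cyc n \<sigma> * t ^ fixs n \<sigma>)
      \<and> \<gamma> j \<alpha> t = 2 powi (2 * int j - int n) *
          (\<Sum>\<sigma> | \<sigma> \<in> MM (n + 1) \<and> pk (n + 1) \<sigma> = j + 1.
            \<alpha> ^ (lmax (n + 1) \<sigma> + rmax (n + 1) \<sigma> - 2)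
            * t ^ (lmaxda (n + 1) \<sigma> + rmaxdd (n + 1) \<sigma>))
      \<and> \<gamma> j \<alpha> t = 2 powi (2 * int j - int n) *
          (\<Sum>\<sigma> | \<sigma> \<in> Sym n \<and> cpk n \<sigma> = j.
            \<alpha> ^ cyc n \<sigma> * (2 * t) ^ fixs n \<sigma>))"
proof -
  have scale: "gamma_coeff n j \<alpha> t = 2 powi (2 * int j - int n) *
      (\<Sum>\<sigma> | \<sigma> \<in> Sym n \<and> cpk n \<sigma> = j. \<alpha> ^ cyc n \<sigma> * (2 * t) ^ fixs n \<sigma>)"
    if "j \<le> n div 2" for j and \<alpha> t :: 'a
  proof -
    have le: "2 * j \<le> n" using that by simp
    then have "2 * int j - int n = - int (n - 2 * j)" by simp
    then have "2 powi (2 * int j - int n) * (2 ^ (n - 2 * j) :: 'a) = 1"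
      by (simp only: power_int_minus power_int_of_nat) simp
    then show ?thesis
      unfolding gamma_cyclic_peaks[OF le, symmetric] mult.assoc[symmetric] by simp
  qed
  show ?thesis
    by (intro exI[of _ "gamma_coeff n"] conjI allI impI)
      (simp_all only: binomial_Eulerian_gamma_expansion sum_MM_peaks_eq_sum_Sym_cyclic_peaks
        gamma_eq_no_da[symmetric] gamma_eq_no_cda[symmetric]
        gamma_eq_no_dd[symmetric] gamma_eq_no_cdd[symmetric] scale[symmetric])
qed

end
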